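(* Let $\alpha\in(0,1)$, $\sigma>0$, let $(\overline U_-,\overline U_+)$ be a special shock state pair. Assume that $(w_{en},q_{en})\in C^7([0,r_0])^2$, $p_{ex}\in C^{2,\alpha}([0,r_0])$, that the structural conditions (S1)–(S7) of the context hold, that the supersonic problem (E), (IB) satisfies the compatibility conditions up to the seventh order, and that $$I_3:=\int_0^{r_0}\frac{i_1(r)}{\bar q_-^2(r)}\frac{\bar w_-(r)}{r}w_{en}(r)\,dr>0,$$ where $$i_1(r):=\bar p_+^{\frac1\gamma}(r)\Big((1-\kappa_1(r))\Big(\frac{\bar w_+^2(r)}{\bar c_+^2(r)}-\frac{\bar w_-^2(r)}{\bar c_-^2(r)}\Big)+r\kappa_3(r)-r\partial_r\kappa_1(r)\Big).$$ Then there exist a positive constant $C_{(\overline U_-)}$ depending on $\overline U_-$, and a constant $L_*$ satisfying $$0<L_*<\frac{4I_3}{C_{(\overline U_-)}\big(\|w_{en}\|_{H^7(\Gamma_{en})}+\|q_{en}\|_{H^7(\Gamma_{en})}\big)\int_0^{r_0}|i_1(r)|\,dr},$$ such that if $$0<I_2\le L_*^2\Big(I_3-\frac{C_{(\overline U_-)}\big(\|w_{en}\|_{H^7(\Gamma_{en})}+\|q_{en}\|_{H^7(\Gamma_{en})}\big)}{6}L_*\int_0^{r_0}|i_1(r)|\,dr\Big),$$ then there exists a unique $\dot z_*\in(0,L_* )$ such that $I_1(\dot z_* )=\sigma I_2$.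
   Context: **Constants and variables.** $\gamma>1$, $A>0$, $c_v>0$, $L>0$, $r_0>0$; $\mu^2=\frac{\gamma-1}{\gamma+1}$. $\Omega=\{(z,r):0<z<L,\ 0\le r<r_0\}$, $\Gamma_{en}=\{z=0,\ 0\le r<r_0\}$, $\Gamma_a=\{r=0,\ 0<z<L\}$, $\Gamma_w=\{r=r_0,\ 0<z<L\}$. A state is $U=(p,\theta,w,q,s)^\top$, with $u=q\cos\theta$, $v=q\sin\theta$, density $\rho$ from $p=Ae^{s/c_v}\rho^\gamma$, $c^2=\gamma p/\rho$, $i=\frac{\gamma p}{(\gamma-1)\rho}$. $H^7(\Gamma_{en})$ is the Sobolev norm for functions of $r\in[0,r_0]$. **Special shock state pair.** $C^7$ functions $\overline U_\pm(r)=(\bar p_\pm,0,\bar w_\pm,\bar q_\pm,\bar s_\pm)^\top$ on $[0,r_0]$ with $\bar p_\pm,\bar\rho_\pm,\bar q_\pm>0$, $\overline M_->1$, $\partial_r\bar p_\pm=\frac1r\bar\rho_\pm\bar w_\pm^2$, and $\bar p_+=((1+\mu^2)\overline M_-^2-\mu^2)\bar p_-$, $\bar q_+=\mu^2(\bar q_-+\frac{2}{\gamma-1}\frac{\bar c_-^2}{\bar q_-})$, $\bar\rho_+=\bar\rho_-\bar q_-/\bar q_+$, $\bar w_+=\bar w_-$. Here $\bar c_\pm^2=\gamma\bar p_\pm/\bar\rho_\pm$, $\overline M_\pm=\bar q_\pm/\bar c_\pm$, $[\bar p]=\bar p_+-\bar p_-$. **(S) Structural conditions.** (S1) $w_{en}(r)\ne0$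 for some $r\in(0,r_0)$. (S2) $\bar w_-(0)=\bar w_-(r_0)=0$. (S3) $\partial_r\bar q_-(0)=\partial_r\bar q_-(r_0)=0$. (S4) $\partial_r^k\bar w_-(0)=0$ for $k=2,4,6$ and $\partial_r^j\bar q_-(0)=0$ for $j=3,5,7$. (S5) $\partial_r^kw_{en}(0)=w_{en}(r_0)=0$ for $k=0,2,4,6$. (S6) $\partial_r^jq_{en}(0)=\partial_rq_{en}(r_0)=0$ for $j=1,3,5,7$. (S7) $\partial_rp_{ex}(0)=\partial_rp_{ex}(r_0)=0$. **(E) Axisymmetric Euler system.** $\partial_z(r\rho u)+\partial_r(r\rho v)=0$; $\partial_z(p+\rho u^2)+\partial_r(\rho uv)+\frac{\rho uv}{r}=0$; $\partial_z(\rho uv)+\partial_r(p+\rho v^2)+\frac{\rho(v^2-w^2)}{r}=0$; $\partial_z(\rho uw)+\partial_r(\rho vw)+\frac{2\rho vw}{r}=0$; $\partial_z\big(r\rho u(\frac12(q^2+w^2)+i)\big)+\partial_r\big(r\rho v(\frac12(q^2+w^2)+i)\big)=0$. **(IB) and compatibility.** (IB): $U(0,r)=\overline U_-(r)+\sigma(0,0,w_{en},q_{en},0)^\top$ on $\Gamma_{en}$, $\theta=0$ on $\Gamma_w$, $\theta=w=0$ on $\Gamma_a$. Compatibility up to order seven: writing (E) as $A(U)U_z+B(U)U_r+C(U)=0$, the derivatives of $U$ up to order 7 at the corners $(0,0)$ and $(0,r_0)$, as determined by the equations, their differentiated versions and the $r$-derivatives of the initial data, are consistent with the tangential derivatives $\partial_z^j\theta=0$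 on $\Gamma_w\cup\Gamma_a$, $\partial_z^jw=0$ on $\Gamma_a$, $0\le j\le7$. **Linearized supersonic flow.** $\dot U_-=(\dot p_-,\dot\theta_-,\dot w_-,\dot q_-,\dot s_-)^\top$ is the solution in $\Omega$ of $\partial_z(\frac{1-\overline M_-^2}{\bar\rho_-\bar q_-^2}\dot p_-)-(\partial_r\dot\theta_-+\frac1r(1+\frac{\overline M_-^2\bar w_-^2}{\bar q_-^2})\dot\theta_-)=0$; $\partial_z(\bar\rho_-\bar q_-^2\dot\theta_-)+\partial_r\dot p_--\frac1r\frac{\overline M_-^2\bar w_-^2}{\bar q_-^2}\dot p_--\frac{2\bar\rho_-\bar w_-}{r}\dot w_-+\frac{1}{\gamma c_v}\frac{\bar\rho_-\bar w_-^2}{r}\dot s_-=0$; $\partial_z(r\dot w_-)+\partial_r(r\bar w_-)\dot\theta_-=0$; $\partial_z(\dot p_-+\bar\rho_-\bar q_-\dot q_-)+\bar\rho_-\bar q_-\partial_r\bar q_-\,\dot\theta_-=0$; $\partial_z\dot s_-+\partial_r\bar s_-\,\dot\theta_-=0$; with $\dot U_-(0,r)=(0,0,\sigma w_{en},\sigma q_{en},0)^\top$, $\dot\theta_-=0$ on $\Gamma_w$, $\dot\theta_-=\dot w_-=0$ on $\Gamma_a$. **Functionals.** $\kappa_1=\big(\frac1{\bar\rho_+\bar q_+^2}+\frac{\gamma-1}{\gamma\bar p_+}\big)[\bar p]$, $\kappa_2=\big(\frac1{\bar q_+\bar q_-}-\frac{\gamma-1}{\bar c_+^2}\big)(\bar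 q_+-\bar q_-)-\frac{\kappa_1}{\bar q_-}$, $\kappa_3=\big(1-\kappa_1-\frac{\bar\rho_+\bar p_-}{\bar\rho_-\bar p_+}\big)\frac{\partial_r\bar s_-}{\gamma c_v}+\big(\kappa_1+(\frac1{\bar q_+}-\frac{(\gamma-1)\bar q_-}{\bar c_+^2})(\bar q_--\bar q_+)\big)\frac{\partial_r\bar q_-}{\bar q_-}$, $I_1(z)=\int_0^{r_0}r\bar p_+^{1/\gamma}(1-\kappa_1)\frac{\overline M_-^2-1}{\bar\rho_-\bar q_-^2}\dot p_-(z,r)\,dr+\int_0^{r_0}\int_0^zr\bar p_+^{1/\gamma}\kappa_3\dot\theta_-(\tau,r)\,d\tau\,dr$, $I_2=\int_0^{r_0}\frac{\overline M_+^2-1}{\bar\rho_+\bar q_+^2}r\bar p_+^{1/\gamma}p_{ex}\,dr-\int_0^{r_0}r\bar p_+^{1/\gamma}\kappa_2q_{en}\,dr$. *)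

theory Defs
  imports "HOL-Analysis.Analysis"
begin

section \<open>Function spaces on a closed interval\<close>

text \<open>The derivative of a function of \<open>r \<in> [0, r0]\<close>; it is one-sided at the two end points.\<close>

definition rderiv :: "real \<Rightarrow> (real \<Rightarrow> real) \<Rightarrow> real \<Rightarrow> real" where
  "rderiv r0 f r = vector_derivative f (at r within {0..r0})"

definition CK :: "nat \<Rightarrow> real \<Rightarrow> (real \<Rightarrow> real) \<Rightarrow> bool" where
  "CK k r0 f \<longleftrightarrow>
     (\<forall>j<k. (rderiv r0 ^^ j) f differentiable_on {0..r0}) \<and>
     continuous_on {0..r0} ((rderiv r0 ^^ k) f)"

definition C2_holder :: "real \<Rightarrow> real \<Rightarrow> (real \<Rightarrow> real) \<Rightarrow> bool" where
  "C2_holder \<alpha> r0 f \<longleftrightarrow> CK 2 r0 f \<and>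
     (\<exists>K. \<forall>x\<in>{0..r0}. \<forall>y\<in>{0..r0}.
        \<bar>(rderiv r0 ^^ 2) f x - (rderiv r0 ^^ 2) f y\<bar> \<le> K * \<bar>x - y\<bar> powr \<alpha>)"

text \<open>The norm of \<open>H\<^sup>7(0, r0)\<close>, with respect to the unweighted measure \<open>dr\<close>. It is only applied to
  functions of class \<open>C\<^sup>7\<close>, whose weak derivatives are the classical ones.\<close>

definition H7_norm :: "real \<Rightarrow> (real \<Rightarrow> real) \<Rightarrow> real" where
  "H7_norm r0 f = sqrt (\<Sum>j\<le>7. integral {0..r0} (\<lambda>r. ((rderiv r0 ^^ j) f r)\<^sup>2))"

section \<open>Flow states\<close>

text \<open>A state \<open>U = (p, \<theta>, w, q, s)\<close>: pressure, flow angle, swirl velocity, speed of the \<open>(z, r)\<close>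
  velocity components, entropy.\<close>

record flow_state =
  st_p :: real
  st_th :: real
  st_w :: real
  st_q :: real
  st_s :: real

definition state_CK :: "nat \<Rightarrow> real \<Rightarrow> (real \<Rightarrow> flow_state) \<Rightarrow> bool" where
  "state_CK k r0 U \<longleftrightarrow>
     CK k r0 (\<lambda>r. st_p (U r)) \<and> CK k r0 (\<lambda>r. st_th (U r)) \<and> CK k r0 (\<lambda>r. st_w (U r)) \<and>
     CK k r0 (\<lambda>r. st_q (U r)) \<and> CK k r0 (\<lambda>r. st_s (U r))"

definition vel_z :: "flow_state \<Rightarrow> real" where
  "vel_z U = st_q U * cos (st_th U)"

definition vel_r :: "flow_state \<Rightarrow> real" where
  "vel_r U = st_q U * sin (st_th U)"

context
  fixes \<gamma> A cv r0 :: real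
begin

definition mu2 :: real where
  "mu2 = (\<gamma> - 1) / (\<gamma> + 1)"

text \<open>The equation of state \<open>p = A exp (s / cv) \<rho>\<^sup>\<gamma>\<close>, solved for \<open>\<rho>\<close> (for \<open>p > 0\<close>).\<close>

definition dens :: "flow_state \<Rightarrow> real" where
  "dens U = (st_p U / (A * exp (st_s U / cv))) powr (1 / \<gamma>)"

definition sound2 :: "flow_state \<Rightarrow> real" where
  "sound2 U = \<gamma> * st_p U / dens U"

definition mach :: "flow_state \<Rightarrow> real" where
  "mach U = st_q U / sqrt (sound2 U)"

definition enthalpy :: "flow_state \<Rightarrow> real" where
  "enthalpy U = \<gamma> * st_p U / ((\<gamma> - 1) * dens U)"

definition special_shock_pair :: "(real \<Rightarrow> flow_state) \<Rightarrow> (real \<Rightarrow> flow_state) \<Rightarrow> bool" where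
  "special_shock_pair Um Up \<longleftrightarrow>
     state_CK 7 r0 Um \<and> state_CK 7 r0 Up \<and>
     (\<forall>r\<in>{0..r0}.
        st_th (Um r) = 0 \<and> st_th (Up r) = 0 \<and>
        st_p (Um r) > 0 \<and> st_p (Up r) > 0 \<and>
        dens (Um r) > 0 \<and> dens (Up r) > 0 \<and>
        st_q (Um r) > 0 \<and> st_q (Up r) > 0 \<and>
        mach (Um r) > 1 \<and>
        st_p (Up r) = ((1 + mu2) * (mach (Um r))\<^sup>2 - mu2) * st_p (Um r) \<and>
        st_q (Up r) = mu2 * (st_q (Um r) + 2 / (\<gamma> - 1) * (sound2 (Um r) / st_q (Um r))) \<and>
        dens (Up r) = dens (Um r) * st_q (Um r) / st_q (Up r) \<and>
        st_w (Up r) = st_w (Um r)) \<and>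
     (\<forall>r\<in>{0<..r0}.
        rderiv r0 (\<lambda>r. st_p (Um r)) r = 1 / r * dens (Um r) * (st_w (Um r))\<^sup>2 \<and>
        rderiv r0 (\<lambda>r. st_p (Up r)) r = 1 / r * dens (Up r) * (st_w (Up r))\<^sup>2)"

section \<open>Structural conditions on the background state, the entrance data and the exit pressure\<close>

definition structural_bg :: "(real \<Rightarrow> flow_state) \<Rightarrow> bool" where
  "structural_bg Um \<longleftrightarrow>
     st_w (Um 0) = 0 \<and> st_w (Um r0) = 0 \<and>
     rderiv r0 (\<lambda>r. st_q (Um r)) 0 = 0 \<and> rderiv r0 (\<lambda>r. st_q (Um r)) r0 = 0 \<and>
     (\<forall>k\<in>{2,4,6}. (rderiv r0 ^^ k) (\<lambda>r. st_w (Um r)) 0 = 0) \<and>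
     (\<forall>j\<in>{3,5,7}. (rderiv r0 ^^ j) (\<lambda>r. st_q (Um r)) 0 = 0)"

definition structural_en :: "(real \<Rightarrow> real) \<Rightarrow> (real \<Rightarrow> real) \<Rightarrow> bool" where
  "structural_en wen qen \<longleftrightarrow>
     (\<exists>r\<in>{0<..<r0}. wen r \<noteq> 0) \<and>
     (\<forall>k\<in>{0,2,4,6}. (rderiv r0 ^^ k) wen 0 = 0) \<and> wen r0 = 0 \<and>
     (\<forall>j\<in>{1,3,5,7}. (rderiv r0 ^^ j) qen 0 = 0) \<and> rderiv r0 qen r0 = 0"

definition structural_ex :: "(real \<Rightarrow> real) \<Rightarrow> bool" where
  "structural_ex pex \<longleftrightarrow> rderiv r0 pex 0 = 0 \<and> rderiv r0 pex r0 = 0"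

section \<open>The Euler system and the compatibility conditions\<close>

text \<open>A triple \<open>(F, G, H)\<close> stands for the equation
  \<open>\<partial>\<^sub>z (F r U) + \<partial>\<^sub>r (G r U) + H r U = 0\<close>.\<close>

definition euler_system ::
  "((real \<Rightarrow> flow_state \<Rightarrow> real) \<times> (real \<Rightarrow> flow_state \<Rightarrow> real) \<times> (real \<Rightarrow> flow_state \<Rightarrow> real)) list" where
  "euler_system =
    [(\<lambda>r U. r * dens U * vel_z U,
      \<lambda>r U. r * dens U * vel_r U,
      \<lambda>r U. 0),
     (\<lambda>r U. st_p U + dens U * (vel_z U)\<^sup>2,
      \<lambda>r U. dens U * vel_z U * vel_r U,
      \<lambda>r U. dens U * vel_z U * vel_r U / r),
     (\<lambda>r U. dens U * vel_z U * vel_r U,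
      \<lambda>r U. st_p U + dens U * (vel_r U)\<^sup>2,
      \<lambda>r U. dens U * ((vel_r U)\<^sup>2 - (st_w U)\<^sup>2) / r),
     (\<lambda>r U. dens U * vel_z U * st_w U,
      \<lambda>r U. dens U * vel_r U * st_w U,
      \<lambda>r U. 2 * dens U * vel_r U * st_w U / r),
     (\<lambda>r U. r * dens U * vel_z U * (1 / 2 * ((st_q U)\<^sup>2 + (st_w U)\<^sup>2) + enthalpy U),
      \<lambda>r U. r * dens U * vel_r U * (1 / 2 * ((st_q U)\<^sup>2 + (st_w U)\<^sup>2) + enthalpy U),
      \<lambda>r U. 0)]"

definition entrance_state ::
  "real \<Rightarrow> (real \<Rightarrow> real) \<Rightarrow> (real \<Rightarrow> real) \<Rightarrow> (real \<Rightarrow> flow_state) \<Rightarrow> real \<Rightarrow> flow_state" where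
  "entrance_state \<sigma> wen qen Um r =
     (Um r)\<lparr>st_w := st_w (Um r) + \<sigma> * wen r, st_q := st_q (Um r) + \<sigma> * qen r\<rparr>"

text \<open>\<open>J j r\<close> plays the role of \<open>\<partial>\<^sub>z\<^sup>j U (0, r)\<close>; the following is the \<open>z\<close>-polynomial of degree 7
  with these derivatives at \<open>z = 0\<close>.\<close>

definition jet_state :: "(nat \<Rightarrow> real \<Rightarrow> flow_state) \<Rightarrow> real \<Rightarrow> real \<Rightarrow> flow_state" where
  "jet_state J z r =
     \<lparr>st_p = (\<Sum>j\<le>7. st_p (J j r) * z ^ j / fact j),
      st_th = (\<Sum>j\<le>7. st_th (J j r) * z ^ j / fact j),
      st_w = (\<Sum>j\<le>7. st_w (J j r) * z ^ j / fact j),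
      st_q = (\<Sum>j\<le>7. st_q (J j r) * z ^ j / fact j),
      st_s = (\<Sum>j\<le>7. st_s (J j r) * z ^ j / fact j)\<rparr>"

text \<open>The functions \<open>J 0, \<dots>, J 7\<close> are the \<open>z\<close>-derivatives of \<open>U\<close> on the entrance that the Euler
  equations and their differentiated versions determine from the initial data: the second
  condition below says \<open>\<partial>\<^sub>z\<^sup>k (\<partial>\<^sub>z F + \<partial>\<^sub>r G + H) = 0\<close> at \<open>z = 0\<close> for \<open>k \<le> 6\<close>. Here
  \<open>\<partial>\<^sub>z\<^sup>k (G r U)\<close> at \<open>z = 0\<close> involves only \<open>J 0, \<dots>, J 6\<close> and is therefore differentiable in \<open>r\<close>.
  As \<open>J j\<close> is of class \<open>C\<close> to the power \<open>7 - j\<close> up to \<open>r = 0\<close> and \<open>r = r0\<close>, all derivatives of \<open>U\<close>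
  of total order at most 7 are defined at the two corners (at the singular end point \<open>r = 0\<close> by
  continuous extension of the relations that hold for \<open>r > 0\<close>). The last condition is the agreement
  with the tangential derivatives prescribed on the wall and on the axis.\<close>

definition compatible7 ::
  "real \<Rightarrow> (real \<Rightarrow> real) \<Rightarrow> (real \<Rightarrow> real) \<Rightarrow> (real \<Rightarrow> flow_state) \<Rightarrow> bool" where
  "compatible7 \<sigma> wen qen Um \<longleftrightarrow>
     (\<exists>J :: nat \<Rightarrow> real \<Rightarrow> flow_state.
        (\<forall>r\<in>{0..r0}. J 0 r = entrance_state \<sigma> wen qen Um r) \<and>
        (\<forall>j\<le>7. state_CK (7 - j) r0 (J j)) \<and>
        (\<forall>k\<le>6. \<forall>r\<in>{0<..<r0}. \<forall>(F, G, H)\<in>set euler_system.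
           (deriv ^^ Suc k) (\<lambda>z. F r (jet_state J z r)) 0
           + rderiv r0 (\<lambda>x. (deriv ^^ k) (\<lambda>z. G x (jet_state J z x)) 0) r
           + (deriv ^^ k) (\<lambda>z. H r (jet_state J z r)) 0 = 0) \<and>
        (\<forall>j\<le>7. st_th (J j r0) = 0 \<and> st_th (J j 0) = 0 \<and> st_w (J j 0) = 0))"

end

section \<open>The linearized supersonic flow\<close>

definition pdz :: "real \<Rightarrow> (real \<Rightarrow> real \<Rightarrow> real) \<Rightarrow> real \<Rightarrow> real \<Rightarrow> real" where
  "pdz L f z r = vector_derivative (\<lambda>z. f z r) (at z within {0..<L})"

definition pdr :: "real \<Rightarrow> (real \<Rightarrow> real \<Rightarrow> real) \<Rightarrow> real \<Rightarrow> real \<Rightarrow> real" where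
  "pdr r0 f z r = rderiv r0 (f z) r"

text \<open>Functions that are \<open>C\<^sup>1\<close> on \<open>[0, L) \<times> [0, r0]\<close>, that is, up to the entrance, the axis and
  the wall\<close>

definition C1_nozzle :: "real \<Rightarrow> real \<Rightarrow> (real \<Rightarrow> real \<Rightarrow> real) \<Rightarrow> bool" where
  "C1_nozzle L r0 f \<longleftrightarrow>
     (\<forall>z\<in>{0..<L}. \<forall>r\<in>{0..r0}.
        (\<lambda>z. f z r) differentiable (at z within {0..<L}) \<and>
        f z differentiable (at r within {0..r0})) \<and>
     continuous_on ({0..<L} \<times> {0..r0}) (\<lambda>(z, r). f z r) \<and>
     continuous_on ({0..<L} \<times> {0..r0}) (\<lambda>(z, r). pdz L f z r) \<and>
     continuous_on ({0..<L} \<times> {0..r0}) (\<lambda>(z, r). pdr r0 f z r)"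

context
  fixes \<gamma> A cv L r0 :: real
begin

text \<open>\<open>dU\<close> is a (classical) solution of the linearized initial boundary value problem. The
  differential equations have coefficients singular at \<open>r = 0\<close> and are imposed for \<open>r > 0\<close>.\<close>

definition linearized_flow ::
  "(real \<Rightarrow> flow_state) \<Rightarrow> real \<Rightarrow> (real \<Rightarrow> real) \<Rightarrow> (real \<Rightarrow> real) \<Rightarrow> (real \<Rightarrow> real \<Rightarrow> flow_state) \<Rightarrow> bool" where
  "linearized_flow Um \<sigma> wen qen dU \<longleftrightarrow>
    (let dp = (\<lambda>z r. st_p (dU z r)); dth = (\<lambda>z r. st_th (dU z r));
         dw = (\<lambda>z r. st_w (dU z r)); dq = (\<lambda>z r. st_q (dU z r)); ds = (\<lambda>z r. st_s (dU z r));
         rho = (\<lambda>r. dens \<gamma> A cv (Um r)); M = (\<lambda>r. mach \<gamma> A cv (Um r));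
         w = (\<lambda>r. st_w (Um r)); q = (\<lambda>r. st_q (Um r)); s = (\<lambda>r. st_s (Um r))
     in
      C1_nozzle L r0 dp \<and> C1_nozzle L r0 dth \<and> C1_nozzle L r0 dw \<and>
      C1_nozzle L r0 dq \<and> C1_nozzle L r0 ds \<and>
      (\<forall>z\<in>{0<..<L}. \<forall>r\<in>{0<..<r0}.
         pdz L (\<lambda>z r. (1 - (M r)\<^sup>2) / (rho r * (q r)\<^sup>2) * dp z r) z r
           - (pdr r0 dth z r + 1 / r * (1 + (M r)\<^sup>2 * (w r)\<^sup>2 / (q r)\<^sup>2) * dth z r) = 0 \<and>
         pdz L (\<lambda>z r. rho r * (q r)\<^sup>2 * dth z r) z r + pdr r0 dp z r
           - 1 / r * ((M r)\<^sup>2 * (w r)\<^sup>2 / (q r)\<^sup>2) * dp z r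
           - 2 * rho r * w r / r * dw z r
           + 1 / (\<gamma> * cv) * (rho r * (w r)\<^sup>2 / r) * ds z r = 0 \<and>
         pdz L (\<lambda>z r. r * dw z r) z r + rderiv r0 (\<lambda>r. r * w r) r * dth z r = 0 \<and>
         pdz L (\<lambda>z r. dp z r + rho r * q r * dq z r) z r
           + rho r * q r * rderiv r0 q r * dth z r = 0 \<and>
         pdz L ds z r + rderiv r0 s r * dth z r = 0) \<and>
      (\<forall>r\<in>{0..<r0}.
         dU 0 r = \<lparr>st_p = 0, st_th = 0, st_w = \<sigma> * wen r, st_q = \<sigma> * qen r, st_s = 0\<rparr>) \<and>
      (\<forall>z\<in>{0<..<L}. dth z r0 = 0 \<and> dth z 0 = 0 \<and> dw z 0 = 0))"

end

section \<open>The functionals\<close>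

context
  fixes \<gamma> A cv r0 :: real and Um Up :: "real \<Rightarrow> flow_state"
begin

definition kappa1 :: "real \<Rightarrow> real" where
  "kappa1 r =
     (1 / (dens \<gamma> A cv (Up r) * (st_q (Up r))\<^sup>2) + (\<gamma> - 1) / (\<gamma> * st_p (Up r)))
       * (st_p (Up r) - st_p (Um r))"

definition kappa2 :: "real \<Rightarrow> real" where
  "kappa2 r =
     (1 / (st_q (Up r) * st_q (Um r)) - (\<gamma> - 1) / sound2 \<gamma> A cv (Up r))
       * (st_q (Up r) - st_q (Um r))
     - kappa1 r / st_q (Um r)"

definition kappa3 :: "real \<Rightarrow> real" where
  "kappa3 r =
     (1 - kappa1 r - dens \<gamma> A cv (Up r) * st_p (Um r) / (dens \<gamma> A cv (Um r) * st_p (Up r)))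
       * (rderiv r0 (\<lambda>r. st_s (Um r)) r / (\<gamma> * cv))
     + (kappa1 r + (1 / st_q (Up r) - (\<gamma> - 1) * st_q (Um r) / sound2 \<gamma> A cv (Up r))
          * (st_q (Um r) - st_q (Up r)))
       * (rderiv r0 (\<lambda>r. st_q (Um r)) r / st_q (Um r))"

definition I1 :: "(real \<Rightarrow> real \<Rightarrow> flow_state) \<Rightarrow> real \<Rightarrow> real" where
  "I1 dU z =
     integral {0..r0} (\<lambda>r. r * st_p (Up r) powr (1 / \<gamma>) * (1 - kappa1 r)
       * (((mach \<gamma> A cv (Um r))\<^sup>2 - 1) / (dens \<gamma> A cv (Um r) * (st_q (Um r))\<^sup>2))
       * st_p (dU z r))
     + integral {0..r0} (\<lambda>r. integral {0..z} (\<lambda>\<tau>.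
         r * st_p (Up r) powr (1 / \<gamma>) * kappa3 r * st_th (dU \<tau> r)))"

definition I2 :: "(real \<Rightarrow> real) \<Rightarrow> (real \<Rightarrow> real) \<Rightarrow> real" where
  "I2 qen pex =
     integral {0..r0} (\<lambda>r. ((mach \<gamma> A cv (Up r))\<^sup>2 - 1) / (dens \<gamma> A cv (Up r) * (st_q (Up r))\<^sup>2)
       * r * st_p (Up r) powr (1 / \<gamma>) * pex r)
     - integral {0..r0} (\<lambda>r. r * st_p (Up r) powr (1 / \<gamma>) * kappa2 r * qen r)"

definition i1 :: "real \<Rightarrow> real" where
  "i1 r = st_p (Up r) powr (1 / \<gamma>) *
     ((1 - kappa1 r) * ((st_w (Up r))\<^sup>2 / sound2 \<gamma> A cv (Up r) - (st_w (Um r))\<^sup>2 / sound2 \<gamma> A cv (Um r))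
      + r * kappa3 r - r * rderiv r0 kappa1 r)"

text \<open>The value of the integrand at the single point \<open>r = 0\<close>, where \<open>w / r\<close> is \<open>0\<close> by the
  convention on division, does not affect the integral.\<close>

definition I3 :: "(real \<Rightarrow> real) \<Rightarrow> real" where
  "I3 wen = integral {0..r0} (\<lambda>r. i1 r / (st_q (Um r))\<^sup>2 * (st_w (Um r) / r) * wen r)"

end

end

theory Submission
  imports Defs
begin

text \<open>
  The functional \<open>I1\<close> behaves near the entrance like \<open>\<sigma> * I3 * z\<^sup>2\<close>, with an error of third
  order in \<open>z\<close> whose constant is as small as desired; hence it is strictly increasing on a short
  interval \<open>[0, Ls]\<close> and takes every value between \<open>0\<close> and the bound of the theorem exactly once.

  The first derivative of \<open>I1\<close> is \<open>\<integral> i1 \<theta> dr\<close> (lemma \<open>I1_deriv\<close>): the \<open>z\<close>-derivative of the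
  pressure is expressed by the linearized continuity equation, and the term \<open>\<partial>\<^sub>r (r \<theta>)\<close> is
  integrated by parts. The boundary terms vanish as \<open>\<theta>\<close> vanishes on the wall, and the derivative
  of the weight \<open>p\<^sub>+\<close> to the power \<open>1 / \<gamma>\<close> is given by the radial balance of the background.

  The derivative of \<open>\<integral> i1 \<theta> dr\<close> is \<open>2 * \<sigma> * I3 + o(z)\<close> (lemma \<open>moment_deriv\<close>). The linearized
  radial momentum equation gives \<open>\<partial>\<^sub>z \<theta>\<close>; its swirl term, evaluated at the entrance, yields
  \<open>2 * \<sigma> * I3\<close>. The remaining terms contain the pressure, the entropy and the increment of the
  swirl. Since \<open>\<theta> = 0\<close> on the entrance, the \<open>z\<close>-derivatives of these three vanish there, so
  that all three are \<open>o(z)\<close> uniformly in \<open>r\<close>. The radial derivative of the pressure is integrated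
  by parts against the \<open>C\<^sup>1\<close> weight \<open>i1 / (\<rho> q\<^sup>2)\<close>, so that a solution of class \<open>C\<^sup>1\<close> suffices.

  Two integrations (lemma \<open>I1_lower_bound\<close>) give \<open>I1 z \<ge> \<sigma> * I3 * z\<^sup>2 - \<eta> * z\<^sup>3 / 6\<close> near the
  entrance, for every \<open>\<eta> > 0\<close>. As the length \<open>Ls\<close> may be chosen small depending on the flow, the
  third-order constant can be beaten whatever the value of the constant \<open>C\<close> is, as long as
  the norms of the data and \<open>\<integral> \<bar>i1\<bar> dr\<close> are positive; \<open>C = 1\<close> is used.
\<close>

section \<open>Calculus of functions of class \<open>C\<^sup>k\<close> on a closed interval\<close>

lemma rderiv_eqI:
  assumes "r0 > 0" "r \<in> {0..r0}" "(f has_real_derivative D) (at r within {0..r0})"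
  shows "rderiv r0 f r = D"
  using assms vector_derivative_within_cbox[of 0 r0 r f D]
  by (simp add: rderiv_def has_real_derivative_iff_has_vector_derivative)

lemma has_rderiv:
  assumes "f differentiable (at r within {0..r0})"
  shows "(f has_real_derivative rderiv r0 f r) (at r within {0..r0})"
  using assms
  by (simp add: rderiv_def has_real_derivative_iff_has_vector_derivative vector_derivative_works)

lemma rderiv_cong:
  assumes "r \<in> {0..r0}" "\<And>x. x \<in> {0..r0} \<Longrightarrow> f x = g x"
  shows "rderiv r0 f r = rderiv r0 g r"
proof -
  have "(f has_vector_derivative D) (at r within {0..r0}) \<longleftrightarrow>
        (g has_vector_derivative D) (at r within {0..r0})" for D
    using has_vector_derivative_transform[of r "{0..r0}" f g D]
      has_vector_derivative_transform[of r "{0..r0}" g f D] assms by auto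
  then show ?thesis by (simp add: rderiv_def vector_derivative_def)
qed

lemma CK_0: "CK 0 r0 f \<longleftrightarrow> continuous_on {0..r0} f"
  by (simp add: CK_def)

lemma CK_Suc: "CK (Suc k) r0 f \<longleftrightarrow> f differentiable_on {0..r0} \<and> CK k r0 (rderiv r0 f)"
  unfolding CK_def All_less_Suc2 by (auto simp: funpow_swap1)

lemma CK_cong:
  assumes "\<And>r. r \<in> {0..r0} \<Longrightarrow> f r = g r"
  shows "CK k r0 f \<longleftrightarrow> CK k r0 g"
  using assms
proof (induction k arbitrary: f g)
  case 0
  then show ?case using continuous_on_cong[of "{0..r0}" "{0..r0}" f g] by (simp add: CK_0)
next
  case (Suc k)
  have "f differentiable_on {0..r0} \<longleftrightarrow> g differentiable_on {0..r0}"
    unfolding differentiable_on_def differentiable_def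
    by (intro ball_cong ex_cong1 iffI refl)
      (use Suc.prems in \<open>auto intro: has_derivative_transform[of _ "{0..r0}" f g]
        has_derivative_transform[of _ "{0..r0}" g f]\<close>)
  moreover have "CK k r0 (rderiv r0 f) \<longleftrightarrow> CK k r0 (rderiv r0 g)"
    by (rule Suc.IH) (use Suc.prems rderiv_cong in blast)
  ultimately show ?case by (simp add: CK_Suc)
qed

lemma CK_SucI:
  assumes "r0 > 0" "\<And>r. r \<in> {0..r0} \<Longrightarrow> (f has_real_derivative f' r) (at r within {0..r0})"
    and "CK k r0 f'"
  shows "CK (Suc k) r0 f"
proof -
  have "CK k r0 (rderiv r0 f) \<longleftrightarrow> CK k r0 f'"
    by (rule CK_cong) (use assms rderiv_eqI in blast)
  then show ?thesis
    using assms by (force simp: CK_Suc differentiable_on_def real_differentiable_def)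
qed

lemma CK_Suc_imp_CK: "CK (Suc k) r0 f \<Longrightarrow> CK k r0 f"
  by (auto simp: CK_def dest: differentiable_imp_continuous_on)

lemma CK_mono: "j \<le> k \<Longrightarrow> CK k r0 f \<Longrightarrow> CK j r0 f"
  by (induction k) (auto simp: le_Suc_eq dest: CK_Suc_imp_CK)

lemma CK_continuous_on: "CK k r0 f \<Longrightarrow> continuous_on {0..r0} f"
  using CK_mono[of 0 k] by (simp add: CK_0)

lemma CK_has_rderiv:
  "CK (Suc k) r0 f \<Longrightarrow> r \<in> {0..r0} \<Longrightarrow>
    (f has_real_derivative rderiv r0 f r) (at r within {0..r0})"
  by (auto simp: CK_Suc differentiable_on_def intro: has_rderiv)

lemma CK_const: "r0 > 0 \<Longrightarrow> CK k r0 (\<lambda>_. c)"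
proof (induction k arbitrary: c)
  case (Suc k)
  show ?case by (rule CK_SucI[OF Suc.prems _ Suc.IH[OF Suc.prems, of 0]]) auto
qed (simp add: CK_0)

lemma CK_id: "r0 > 0 \<Longrightarrow> CK k r0 (\<lambda>r. r)"
  by (cases k) (auto simp: CK_0 intro!: CK_SucI[where f' = "\<lambda>_. 1"] CK_const)

lemma CK_add:
  assumes "r0 > 0"
  shows "CK k r0 f \<Longrightarrow> CK k r0 g \<Longrightarrow> CK k r0 (\<lambda>r. f r + g r)"
proof (induction k arbitrary: f g)
  case 0
  then show ?case by (auto simp: CK_0 intro: continuous_intros)
next
  case (Suc k)
  show ?case
  proof (rule CK_SucI[OF assms])
    show "CK k r0 (\<lambda>r. rderiv r0 f r + rderiv r0 g r)"
      using Suc by (auto simp: CK_Suc)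
  qed (use Suc.prems in \<open>auto intro!: derivative_eq_intros CK_has_rderiv\<close>)
qed

lemma CK_mult:
  assumes "r0 > 0"
  shows "CK k r0 f \<Longrightarrow> CK k r0 g \<Longrightarrow> CK k r0 (\<lambda>r. f r * g r)"
proof (induction k arbitrary: f g)
  case 0
  then show ?case by (auto simp: CK_0 intro: continuous_intros)
next
  case (Suc k)
  show ?case
  proof (rule CK_SucI[OF assms])
    show "CK k r0 (\<lambda>r. rderiv r0 f r * g r + f r * rderiv r0 g r)"
      using Suc.prems
      by (intro CK_add assms Suc.IH CK_Suc_imp_CK[OF Suc.prems(1)] CK_Suc_imp_CK[OF Suc.prems(2)])
        (auto simp: CK_Suc)
  qed (use Suc.prems in \<open>auto intro!: derivative_eq_intros CK_has_rderiv\<close>)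
qed

lemma CK_diff:
  assumes "r0 > 0" "CK k r0 f" "CK k r0 g"
  shows "CK k r0 (\<lambda>r. f r - g r)"
  using CK_add[OF assms(1,2) CK_mult[OF assms(1) CK_const[OF assms(1), of _ "-1"] assms(3)]]
  by simp

lemma CK_powr:
  assumes "r0 > 0" "\<And>r. r \<in> {0..r0} \<Longrightarrow> f r > 0"
  shows "CK k r0 f \<Longrightarrow> CK k r0 (\<lambda>r. f r powr a)"
proof (induction k arbitrary: a)
  case 0
  then show ?case
    using assms by (fastforce simp: CK_0 intro!: continuous_intros)
next
  case (Suc k)
  show ?case
  proof (rule CK_SucI[OF assms(1)])
    show "CK k r0 (\<lambda>r. a * (f r powr (a - 1) * rderiv r0 f r))"
      using Suc.prems
      by (intro CK_mult CK_const assms(1) Suc.IH CK_Suc_imp_CK[OF Suc.prems])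
        (auto simp: CK_Suc)
    show "((\<lambda>r. f r powr a) has_real_derivative a * (f r powr (a - 1) * rderiv r0 f r))
        (at r within {0..r0})" if "r \<in> {0..r0}" for r
      using DERIV_chain2[OF has_real_derivative_powr[of "f r" a]
          CK_has_rderiv[OF Suc.prems that]] assms(2)[OF that]
      by (simp add: mult.assoc)
  qed
qed

lemma CK_exp:
  assumes "r0 > 0"
  shows "CK k r0 f \<Longrightarrow> CK k r0 (\<lambda>r. exp (f r))"
proof (induction k)
  case 0
  then show ?case by (auto simp: CK_0 intro: continuous_intros)
next
  case (Suc k)
  show ?case
  proof (rule CK_SucI[OF assms(1)])
    show "CK k r0 (\<lambda>r. exp (f r) * rderiv r0 f r)"
      using Suc.prems by (intro CK_mult assms Suc.IH CK_Suc_imp_CK[OF Suc.prems])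
        (auto simp: CK_Suc)
  qed (use Suc.prems in \<open>auto intro!: derivative_eq_intros CK_has_rderiv\<close>)
qed

lemma CK_divide:
  assumes "r0 > 0" "\<And>r. r \<in> {0..r0} \<Longrightarrow> g r > 0" "CK k r0 f" "CK k r0 g"
  shows "CK k r0 (\<lambda>r. f r / g r)"
proof -
  have "CK k r0 (\<lambda>r. f r * g r powr (-1))"
    by (intro CK_mult CK_powr assms)
  also have "?this \<longleftrightarrow> ?thesis"
    by (rule CK_cong)
      (use assms(2) in \<open>simp add: powr_minus divide_inverse less_imp_le\<close>)
  finally show ?thesis .
qed

lemma CK_power2: "r0 > 0 \<Longrightarrow> CK k r0 f \<Longrightarrow> CK k r0 (\<lambda>r. (f r)\<^sup>2)"
  by (simp add: power2_eq_square CK_mult)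

text \<open>The quotient \<open>f r / r\<close> stays bounded at the axis for \<open>f\<close> vanishing there; its continuous
  extension is prescribed by the derivative of \<open>f\<close>.\<close>

definition axis_quot :: "real \<Rightarrow> (real \<Rightarrow> real) \<Rightarrow> real \<Rightarrow> real" where
  "axis_quot r0 f r = (if r = 0 then rderiv r0 f 0 else f r / r)"

lemma axis_quot_continuous:
  assumes "r0 > 0" "CK (Suc k) r0 f" "f 0 = 0"
  shows "continuous_on {0..r0} (axis_quot r0 f)"
  unfolding continuous_on_eq_continuous_within
proof
  fix r assume r: "r \<in> {0..r0}"
  show "continuous (at r within {0..r0}) (axis_quot r0 f)"
  proof (cases "r = 0")
    case True
    have "((\<lambda>x. (f x - f 0) / (x - 0)) \<longlongrightarrow> rderiv r0 f 0) (at 0 within {0..r0})"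
      using CK_has_rderiv[OF assms(2), of 0] assms(1) by (simp add: has_field_derivative_iff)
    then have "(axis_quot r0 f \<longlongrightarrow> rderiv r0 f 0) (at 0 within {0..r0})"
      by (rule Lim_transform_within[where d = 1])
        (auto simp: axis_quot_def assms(3))
    then show ?thesis using True by (simp add: continuous_within axis_quot_def)
  next
    case False
    have "continuous (at r within {0..r0}) (\<lambda>x. f x / x)"
      using CK_continuous_on[OF assms(2)] r False
      by (intro continuous_at_within_divide continuous_ident)
        (auto simp: continuous_on_eq_continuous_within)
    then show ?thesis
      by (rule continuous_transform_within[where \<delta> = r])
        (use r False in \<open>auto simp: axis_quot_def dist_real_def\<close>)
  qed
qed

lemma integral_square_nonneg: "0 \<le> integral S (\<lambda>r. (f r :: real)\<^sup>2)"
  by (cases "(\<lambda>r. (f r)\<^sup>2) integrable_on S")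
    (auto simp: not_integrable_integral intro: Henstock_Kurzweil_Integration.integral_nonneg)

lemma H7_norm_nonneg: "0 \<le> H7_norm r0 f"
  by (simp add: H7_norm_def sum_nonneg integral_square_nonneg)

lemma H7_norm_pos:
  assumes "r0 > 0" "CK 7 r0 f" "r \<in> {0..r0}" "f r \<noteq> 0"
  shows "0 < H7_norm r0 f"
proof -
  have "continuous_on {0..r0} (\<lambda>r. (f r)\<^sup>2)"
    using CK_continuous_on[OF assms(2)] by (intro continuous_intros)
  then have "integral {0..r0} (\<lambda>r. (f r)\<^sup>2) \<noteq> 0"
    using assms integral_eq_0_iff[of 0 r0 "\<lambda>r. (f r)\<^sup>2"] by auto
  then have "0 < integral {0..r0} (\<lambda>r. (f r)\<^sup>2)"
    using integral_square_nonneg[of "{0..r0}" f] by linarith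
  also have "\<dots> = (\<Sum>j\<in>{0::nat}. integral {0..r0} (\<lambda>r. ((rderiv r0 ^^ j) f r)\<^sup>2))" by simp
  also have "\<dots> \<le> (\<Sum>j\<le>7. integral {0..r0} (\<lambda>r. ((rderiv r0 ^^ j) f r)\<^sup>2))"
    by (rule sum_mono2) (auto simp: integral_square_nonneg)
  finally show ?thesis by (simp add: H7_norm_def)
qed

section \<open>Functions of class \<open>C\<^sup>1\<close> on the nozzle\<close>

lemma pdz_eqI:
  assumes "z \<in> {0..<L}" "((\<lambda>z. f z r) has_real_derivative D) (at z within {0..<L})"
  shows "pdz L f z r = D"
proof -
  have "at z within {0..<L} \<noteq> bot"
  proof (cases "z = 0")
    case True
    then have "at z within {0..<L} = at_right z"
      using assms(1) by (intro at_within_nhd[of _ "{..<L}"]) auto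
    then show ?thesis by simp
  next
    case False
    then have "at z within {0..<L} = at z"
      using assms(1) by (intro at_within_interior) auto
    then show ?thesis by simp
  qed
  then show ?thesis
    using assms(2) unfolding pdz_def has_real_derivative_iff_has_vector_derivative
    by (rule vector_derivative_within)
qed

lemma C1_nozzle_has_pdz:
  assumes "C1_nozzle L r0 f" "z \<in> {0..<L}" "r \<in> {0..r0}"
  shows "((\<lambda>z. f z r) has_real_derivative pdz L f z r) (at z within {0..<L})"
  using assms unfolding C1_nozzle_def pdz_def
  by (auto simp: has_real_derivative_iff_has_vector_derivative vector_derivative_works)

lemma C1_nozzle_has_pdr:
  assumes "C1_nozzle L r0 f" "z \<in> {0..<L}" "r \<in> {0..r0}"
  shows "(f z has_real_derivative pdr r0 f z r) (at r within {0..r0})"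
  using assms unfolding C1_nozzle_def pdr_def by (auto intro: has_rderiv)

lemma C1_nozzle_continuous:
  assumes "C1_nozzle L r0 f"
  shows "continuous_on ({0..<L} \<times> {0..r0}) (\<lambda>(z, r). f z r)"
    "continuous_on ({0..<L} \<times> {0..r0}) (\<lambda>(z, r). pdz L f z r)"
    "continuous_on ({0..<L} \<times> {0..r0}) (\<lambda>(z, r). pdr r0 f z r)"
  using assms by (auto simp: C1_nozzle_def)

lemma continuous_on_slice_z:
  assumes "continuous_on ({0..<L} \<times> {0..r0}) (\<lambda>(z, r). f z r)" "r \<in> {0..r0}"
  shows "continuous_on {0..<L} (\<lambda>z. f z r)"
  by (rule continuous_on_compose2[OF assms(1), where f = "\<lambda>z. (z, r)", simplified])
    (use assms in \<open>auto intro!: continuous_intros\<close>)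

lemma continuous_on_slice_r:
  assumes "continuous_on ({0..<L} \<times> {0..r0}) (\<lambda>(z, r). f z r)" "z \<in> {0..<L}"
  shows "continuous_on {0..r0} (f z)"
  by (rule continuous_on_compose2[OF assms(1), where f = "\<lambda>r. (z, r)", simplified])
    (use assms in \<open>auto intro!: continuous_intros\<close>)

text \<open>If \<open>\<partial>\<^sub>z f\<close> vanishes on the entrance, then \<open>f\<close> differs from its entrance values by
  \<open>o(z)\<close>, uniformly in \<open>r\<close>.\<close>

lemma C1_nozzle_small:
  assumes f: "C1_nozzle L r0 f" and "L > 0"
    and zero: "\<And>r. r \<in> {0..r0} \<Longrightarrow> pdz L f 0 r = 0" and "\<epsilon> > 0"
  obtains d where "0 < d" "d < L"
    "\<And>z r. z \<in> {0..d} \<Longrightarrow> r \<in> {0..r0} \<Longrightarrow> \<bar>f z r - f 0 r\<bar> \<le> \<epsilon> * z"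
proof -
  have "uniformly_continuous_on ({0..L/2} \<times> {0..r0}) (\<lambda>(z, r). pdz L f z r)"
    using \<open>L > 0\<close>
    by (intro compact_uniformly_continuous compact_Times
        continuous_on_subset[OF C1_nozzle_continuous(2)[OF f]]) auto
  then obtain e where e: "e > 0" "\<And>x x'. \<lbrakk>x \<in> {0..L/2} \<times> {0..r0}; x' \<in> {0..L/2} \<times> {0..r0};
      dist x' x < e\<rbrakk> \<Longrightarrow> dist ((\<lambda>(z, r). pdz L f z r) x') ((\<lambda>(z, r). pdz L f z r) x) < \<epsilon>"
    using \<open>\<epsilon> > 0\<close> unfolding uniformly_continuous_on_def by metis
  define d where "d = min (L/2) (e/2)"
  have d: "0 < d" "d < L" using e(1) \<open>L > 0\<close> by (auto simp: d_def)
  have bound: "\<bar>pdz L f z r\<bar> \<le> \<epsilon>" if "z \<in> {0..d}" "r \<in> {0..r0}" for z r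
    using e(2)[of "(0, r)" "(z, r)"] zero[OF that(2)] that d e(1)
    by (auto simp: d_def dist_Pair_Pair dist_real_def)
  have "\<bar>f z r - f 0 r\<bar> \<le> \<epsilon> * z" if "z \<in> {0..d}" "r \<in> {0..r0}" for z r
  proof -
    have "norm (f z r - f 0 r) \<le> \<epsilon> * norm (z - 0)"
    proof (rule field_differentiable_bound[where S = "{0..d}" and f = "\<lambda>z. f z r"])
      show "((\<lambda>z. f z r) has_field_derivative pdz L f x r) (at x within {0..d})"
        if "x \<in> {0..d}" for x
        by (rule DERIV_subset[OF C1_nozzle_has_pdz[OF f]]) (use that d \<open>r \<in> {0..r0}\<close> in auto)
    qed (use that bound in auto)
    then show ?thesis using that by simp
  qed
  with that d show ?thesis by blast
qed

lemma eq_at_zero_by_continuity: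
  fixes f g :: "real \<Rightarrow> real"
  assumes "b > 0" "continuous_on {0..<b} f" "continuous_on {0..<b} g"
    and "\<And>x. x \<in> {0<..<b} \<Longrightarrow> f x = g x"
  shows "f 0 = g 0"
proof -
  have "(\<lambda>x. f x - g x) 0 = 0"
  proof (rule continuous_constant_on_closure[where S = "{0<..<b/2}" and f = "\<lambda>x. f x - g x"])
    show "continuous_on (closure {0<..<b/2}) (\<lambda>x. f x - g x)"
      using assms(1) by (intro continuous_intros; intro continuous_on_subset[OF assms(2)]
          continuous_on_subset[OF assms(3)]) auto
  qed (use assms in auto)
  then show ?thesis by simp
qed

lemma eq_on_closed_by_continuity:
  fixes f g :: "real \<Rightarrow> real"
  assumes "b > 0" "continuous_on {0..b} f" "continuous_on {0..b} g"
    and "\<And>x. x \<in> {0<..<b} \<Longrightarrow> f x = g x" and "x \<in> {0..b}"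
  shows "f x = g x"
proof -
  have "(\<lambda>x. f x - g x) x = 0"
    by (rule continuous_constant_on_closure[where S = "{0<..<b}" and f = "\<lambda>x. f x - g x"])
      (use assms in \<open>auto intro!: continuous_intros\<close>)
  then show ?thesis by simp
qed

lemma C1_nozzle_integral_deriv:
  assumes f: "C1_nozzle L r0 f" and a: "continuous_on {0..r0} a" and z: "z \<in> {0..<L}"
  shows "((\<lambda>z. integral {0..r0} (\<lambda>r. a r * f z r)) has_real_derivative
      integral {0..r0} (\<lambda>r. a r * pdz L f z r)) (at z within {0..<L})"
proof (rule leibniz_rule_field_derivative[of "{0..<L}" 0 r0 "\<lambda>z r. a r * f z r"
      "\<lambda>z r. a r * pdz L f z r", unfolded box_real])
  have "continuous_on ({0..<L} \<times> {0..r0}) (\<lambda>x. a (snd x) * pdz L f (fst x) (snd x))"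
    using C1_nozzle_continuous(2)[OF f]
    by (intro continuous_on_mult continuous_on_compose2[OF a] continuous_intros)
      (auto simp: split_beta)
  then show "continuous_on ({0..<L} \<times> {0..r0}) (\<lambda>(z, r). a r * pdz L f z r)"
    by (simp add: split_beta)
  show "(\<lambda>r. a r * f x r) integrable_on {0..r0}" if "x \<in> {0..<L}" for x
    using that
    by (intro integrable_continuous_real continuous_on_mult a
        continuous_on_slice_r[OF C1_nozzle_continuous(1)[OF f]]) auto
qed (use z C1_nozzle_has_pdz[OF f] in \<open>auto intro!: DERIV_cmult\<close>)

lemma C1_nozzle_double_integral_deriv:
  assumes f: "C1_nozzle L r0 f" and a: "continuous_on {0..r0} a" and z: "z \<in> {0..<L}"
  shows "((\<lambda>z. integral {0..r0} (\<lambda>r. integral {0..z} (\<lambda>\<tau>. a r * f \<tau> r))) has_real_derivative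
      integral {0..r0} (\<lambda>r. a r * f z r)) (at z within {0..<L})"
proof (rule leibniz_rule_field_derivative[of "{0..<L}" 0 r0
      "\<lambda>z r. integral {0..z} (\<lambda>\<tau>. a r * f \<tau> r)" "\<lambda>z r. a r * f z r", unfolded box_real])
  have cont: "continuous_on ({0..<L} \<times> {0..r0}) (\<lambda>x. a (snd x) * f (fst x) (snd x))"
    using C1_nozzle_continuous(1)[OF f]
    by (intro continuous_on_mult continuous_on_compose2[OF a] continuous_intros)
      (auto simp: split_beta)
  then show cont': "continuous_on ({0..<L} \<times> {0..r0}) (\<lambda>(z, r). a r * f z r)"
    by (simp add: split_beta)
  show "(\<lambda>r. integral {0..x} (\<lambda>\<tau>. a r * f \<tau> r)) integrable_on {0..r0}" if "x \<in> {0..<L}" for x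
  proof -
    have "continuous_on ({0..r0} \<times> {0..x}) (\<lambda>y. (\<lambda>x. a (snd x) * f (fst x) (snd x)) (snd y, fst y))"
      by (rule continuous_on_compose2[OF cont])
        (use that in \<open>auto intro!: continuous_intros\<close>)
    then have "continuous_on ({0..r0} \<times> cbox 0 x) (\<lambda>(r, \<tau>). a r * f \<tau> r)"
      by (simp add: split_beta)
    from integrable_continuous_real[OF integral_continuous_on_param[OF this]]
    show ?thesis by simp
  qed
  show "((\<lambda>z. integral {0..z} (\<lambda>\<tau>. a r * f \<tau> r)) has_real_derivative a r * f x r)
      (at x within {0..<L})" if "x \<in> {0..<L}" "r \<in> {0..r0}" for x r
  proof -
    define b where "b = (x + L) / 2"
    have b: "x < b" "b < L" using that by (auto simp: b_def)
    have "continuous_on {0..b} (\<lambda>\<tau>. a r * f \<tau> r)"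
      using continuous_on_slice_z[OF cont', of r] that b by (auto intro: continuous_on_subset)
    then have "((\<lambda>z. integral {0..z} (\<lambda>\<tau>. a r * f \<tau> r)) has_real_derivative a r * f x r)
        (at x within {0..b})"
      by (rule integral_has_real_derivative) (use that b in auto)
    moreover have "at x within {0..b} = at x within {0..<L}"
      by (rule at_within_nhd[of _ "{..<b}"]) (use b in auto)
    ultimately show ?thesis by simp
  qed
qed (use z in auto)

section \<open>The background state\<close>

text \<open>A special shock state pair whose upstream swirl vanishes on the axis. Radial profiles of
  the upstream state carry no suffix or \<open>m\<close>, those of the downstream state the suffix \<open>p\<close>.
  \<open>P\<close> is the weight \<open>p\<^sub>+\<close> to the power \<open>1 / \<gamma>\<close>, and \<open>W\<close> is \<open>w / r\<close>, extended
  continuously to the axis.\<close>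

locale shock_pair =
  fixes \<gamma> A cv r0 :: real and Um Up :: "real \<Rightarrow> flow_state"
  assumes gamma: "\<gamma> > 1" and A: "A > 0" and cv: "cv > 0" and r0: "r0 > 0"
    and pair: "special_shock_pair \<gamma> A cv r0 Um Up"
    and w_axis: "st_w (Um 0) = 0"
begin

abbreviation "pm \<equiv> \<lambda>r. st_p (Um r)"
abbreviation "pp \<equiv> \<lambda>r. st_p (Up r)"
abbreviation "w \<equiv> \<lambda>r. st_w (Um r)"
abbreviation "q \<equiv> \<lambda>r. st_q (Um r)"
abbreviation "qp \<equiv> \<lambda>r. st_q (Up r)"
abbreviation "s \<equiv> \<lambda>r. st_s (Um r)"
abbreviation "rho \<equiv> \<lambda>r. dens \<gamma> A cv (Um r)"
abbreviation "rhop \<equiv> \<lambda>r. dens \<gamma> A cv (Up r)"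
abbreviation "c2 \<equiv> \<lambda>r. sound2 \<gamma> A cv (Um r)"
abbreviation "c2p \<equiv> \<lambda>r. sound2 \<gamma> A cv (Up r)"
abbreviation "M \<equiv> \<lambda>r. mach \<gamma> A cv (Um r)"
abbreviation "P \<equiv> \<lambda>r. st_p (Up r) powr (1 / \<gamma>)"
abbreviation "k1 \<equiv> kappa1 \<gamma> A cv Um Up"
abbreviation "k3 \<equiv> kappa3 \<gamma> A cv r0 Um Up"
abbreviation "i1' \<equiv> i1 \<gamma> A cv r0 Um Up"
abbreviation "W \<equiv> axis_quot r0 w"

lemma pos:
  assumes "r \<in> {0..r0}"
  shows "pm r > 0" "pp r > 0" "q r > 0" "qp r > 0" "rho r > 0" "rhop r > 0" "c2 r > 0" "c2p r > 0"
    "M r > 1"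
proof -
  show *: "pm r > 0" "pp r > 0" "q r > 0" "qp r > 0" "rho r > 0" "rhop r > 0" "M r > 1"
    using pair assms unfolding special_shock_pair_def by blast+
  show "c2 r > 0" "c2p r > 0"
    unfolding sound2_def using gamma * by auto
qed

lemma swirl_eq: "r \<in> {0..r0} \<Longrightarrow> st_w (Up r) = w r"
  using pair by (auto simp: special_shock_pair_def)

lemma mach_square: "r \<in> {0..r0} \<Longrightarrow> (M r)\<^sup>2 = (q r)\<^sup>2 / c2 r"
  using pos(7)[of r] by (simp add: mach_def power_divide)

lemma CK7:
  "CK 7 r0 pm" "CK 7 r0 pp" "CK 7 r0 w" "CK 7 r0 q" "CK 7 r0 qp" "CK 7 r0 s"
  "CK 7 r0 (\<lambda>r. st_s (Up r))"
  using pair by (auto simp: special_shock_pair_def state_CK_def)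

lemma CK_dens:
  assumes "CK k r0 (\<lambda>r. st_p (U r))" "CK k r0 (\<lambda>r. st_s (U r))"
    and "\<And>r. r \<in> {0..r0} \<Longrightarrow> st_p (U r) > 0"
  shows "CK k r0 (\<lambda>r. dens \<gamma> A cv (U r))"
  unfolding dens_def using A cv
  by (intro CK_powr CK_divide CK_mult CK_const CK_exp r0 assms) (auto simp: assms(3))

lemma CK7_derived:
  "CK 7 r0 rho" "CK 7 r0 rhop" "CK 7 r0 c2" "CK 7 r0 c2p" "CK 7 r0 P" "CK 7 r0 k1"
proof -
  show rho: "CK 7 r0 rho" "CK 7 r0 rhop" by (auto intro: CK_dens CK7 pos)
  show "CK 7 r0 c2" "CK 7 r0 c2p"
    unfolding sound2_def by (auto intro!: CK_divide CK_mult CK_const r0 rho CK7 pos)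
  show "CK 7 r0 P" by (auto intro!: CK_powr r0 CK7 pos)
  show "CK 7 r0 k1" unfolding kappa1_def
    using gamma
    by (intro CK_mult CK_add CK_diff CK_divide CK_const CK_power2 r0 rho CK7)
      (auto simp: pos less_imp_neq[symmetric])
qed

lemma CK6_rderiv: "CK 7 r0 f \<Longrightarrow> CK 6 r0 (rderiv r0 f)"
  using CK_Suc[of 6] by simp

lemma CK6: "CK 7 r0 f \<Longrightarrow> CK 6 r0 f"
  by (rule CK_mono[of 6 7]) auto

lemma CK_has_rderiv7: "CK 7 r0 f \<Longrightarrow> r \<in> {0..r0} \<Longrightarrow>
    (f has_real_derivative rderiv r0 f r) (at r within {0..r0})"
  using CK_has_rderiv[of 6] by simp

lemma CK6_i1: "CK 6 r0 k3" "CK 6 r0 i1'"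
proof -
  show k3: "CK 6 r0 k3" unfolding kappa3_def
    using gamma cv
    by (intro CK_mult CK_add CK_diff CK_divide CK_const CK6_rderiv r0 CK6[OF CK7(1)] CK6[OF CK7(2)]
        CK6[OF CK7(4)] CK6[OF CK7(5)] CK7 CK6[OF CK7_derived(1)] CK6[OF CK7_derived(2)]
        CK6[OF CK7_derived(4)] CK6[OF CK7_derived(6)])
      (auto simp: pos)
  have "CK 6 r0 (\<lambda>r. P r * ((1 - k1 r) * ((w r)\<^sup>2 / c2p r - (w r)\<^sup>2 / c2 r)
      + r * k3 r - r * rderiv r0 k1 r))"
    by (intro CK_mult CK_add CK_diff CK_divide CK_const CK_power2 CK_id CK6_rderiv r0 k3
        CK6[OF CK7(3)] CK7_derived CK6[OF CK7_derived(3)]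
        CK6[OF CK7_derived(4)] CK6[OF CK7_derived(5)] CK6[OF CK7_derived(6)])
      (auto simp: pos)
  also have "?this \<longleftrightarrow> CK 6 r0 i1'"
    by (rule CK_cong) (simp add: i1_def swirl_eq)
  finally show "CK 6 r0 i1'" .
qed

lemma W_continuous: "continuous_on {0..r0} W"
  using axis_quot_continuous[OF r0, of 6 w] CK7(3) w_axis by simp

text \<open>The radial balance \<open>\<partial>\<^sub>r p\<^sub>+ = \<rho>\<^sub>+ w\<^sup>2 / r\<close>, expressed for the weight \<open>P\<close>.\<close>

lemma rderiv_P:
  assumes "r \<in> {0<..r0}"
  shows "rderiv r0 P r = P r * (w r)\<^sup>2 / (r * c2p r)"
proof (rule rderiv_eqI[OF r0])
  from assms show r: "r \<in> {0..r0}" by simp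
  have pp': "rderiv r0 pp r = 1 / r * rhop r * (w r)\<^sup>2"
    using pair assms swirl_eq[OF r] by (auto simp: special_shock_pair_def)
  have "(P has_real_derivative 1 / \<gamma> * pp r powr (1 / \<gamma> - 1) * rderiv r0 pp r)
      (at r within {0..r0})"
    by (rule DERIV_chain2[OF has_real_derivative_powr CK_has_rderiv7[OF CK7(2) r]]) (rule pos(2)[OF r])
  moreover have "pp r powr (1 / \<gamma> - 1) = P r / pp r"
    using pos(2)[OF r] by (simp add: powr_diff)
  then have "1 / \<gamma> * pp r powr (1 / \<gamma> - 1) * rderiv r0 pp r = P r * (w r)\<^sup>2 / (r * c2p r)"
    using pos[OF r] assms gamma
    by (simp add: pp' sound2_def field_simps)
  ultimately show "(P has_real_derivative P r * (w r)\<^sup>2 / (r * c2p r)) (at r within {0..r0})"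
    by simp
qed

end

section \<open>The linearized flow\<close>

text \<open>The background together with a solution \<open>dU\<close> of the linearized problem. \<open>f1\<close> and \<open>f3\<close>
  are the functionals \<open>I1\<close> and \<open>I3\<close> of this flow.\<close>

locale linear_flow = shock_pair +
  fixes L \<sigma> :: real and wen qen :: "real \<Rightarrow> real" and dU :: "real \<Rightarrow> real \<Rightarrow> flow_state"
  assumes L: "L > 0"
    and wen: "CK 7 r0 wen"
    and flow: "linearized_flow \<gamma> A cv L r0 Um \<sigma> wen qen dU"
begin

abbreviation "p \<equiv> \<lambda>z r. st_p (dU z r)"
abbreviation "th \<equiv> \<lambda>z r. st_th (dU z r)"
abbreviation "dw \<equiv> \<lambda>z r. st_w (dU z r)"
abbreviation "ds \<equiv> \<lambda>z r. st_s (dU z r)"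
abbreviation "f1 \<equiv> \<lambda>z. I1 \<gamma> A cv r0 Um Up dU z"
abbreviation "f3 \<equiv> I3 \<gamma> A cv r0 Um Up wen"

lemma C1: "C1_nozzle L r0 p" "C1_nozzle L r0 th" "C1_nozzle L r0 dw" "C1_nozzle L r0 ds"
  using flow by (simp_all add: linearized_flow_def Let_def)

lemma pdz_weighted:
  assumes "C1_nozzle L r0 f" "z \<in> {0..<L}" "r \<in> {0..r0}"
  shows "pdz L (\<lambda>z r. a r * f z r) z r = a r * pdz L f z r"
  using assms by (auto intro!: pdz_eqI DERIV_cmult C1_nozzle_has_pdz)

text \<open>The equations with the \<open>z\<close>-derivatives isolated and \<open>M\<^sup>2 / q\<^sup>2\<close> replaced by \<open>1 / c\<^sup>2\<close>. In the
  second one \<open>w / r\<close> is written as \<open>W\<close>, so that its coefficients are continuous up to the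
  axis.\<close>

lemma flow_eqs:
  assumes z: "z \<in> {0<..<L}" and r: "r \<in> {0<..<r0}"
  shows "((M r)\<^sup>2 - 1) / (rho r * (q r)\<^sup>2) * pdz L p z r
      = - (pdr r0 th z r + 1 / r * (1 + (w r)\<^sup>2 / c2 r) * th z r)" (is ?E1)
    and "rho r * (q r)\<^sup>2 * pdz L th z r
      = - pdr r0 p z r + W r * w r / c2 r * p z r + 2 * rho r * W r * dw z r
        - rho r * w r * W r / (\<gamma> * cv) * ds z r" (is ?E2)
    and "r * pdz L dw z r = - rderiv r0 (\<lambda>r. r * w r) r * th z r" (is ?E3)
    and "pdz L ds z r = - rderiv r0 s r * th z r" (is ?E4)
proof -
  have z': "z \<in> {0..<L}" and r': "r \<in> {0..r0}" using z r by auto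
  note pz = pdz_weighted[OF C1(1) z' r', of "\<lambda>r. (1 - (M r)\<^sup>2) / (rho r * (q r)\<^sup>2)"]
  note tz = pdz_weighted[OF C1(2) z' r', of "\<lambda>r. rho r * (q r)\<^sup>2"]
  note wz = pdz_weighted[OF C1(3) z' r', of "\<lambda>r. r"]
  have "pdz L (\<lambda>z r. (1 - (M r)\<^sup>2) / (rho r * (q r)\<^sup>2) * p z r) z r
           - (pdr r0 th z r + 1 / r * (1 + (M r)\<^sup>2 * (w r)\<^sup>2 / (q r)\<^sup>2) * th z r) = 0 \<and>
         pdz L (\<lambda>z r. rho r * (q r)\<^sup>2 * th z r) z r + pdr r0 p z r
           - 1 / r * ((M r)\<^sup>2 * (w r)\<^sup>2 / (q r)\<^sup>2) * p z r
           - 2 * rho r * w r / r * dw z r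
           + 1 / (\<gamma> * cv) * (rho r * (w r)\<^sup>2 / r) * ds z r = 0 \<and>
         pdz L (\<lambda>z r. r * dw z r) z r + rderiv r0 (\<lambda>r. r * w r) r * th z r = 0 \<and>
         pdz L ds z r + rderiv r0 s r * th z r = 0"
    using flow z r unfolding linearized_flow_def Let_def by blast
  note eqs = this[unfolded pz tz wz]
  have Mq: "(M r)\<^sup>2 * (w r)\<^sup>2 / (q r)\<^sup>2 = (w r)\<^sup>2 / c2 r"
    using pos[OF r'] by (simp add: mach_square[OF r'])
  have neg: "((M r)\<^sup>2 - 1) / (rho r * (q r)\<^sup>2) * pdz L p z r
      = - ((1 - (M r)\<^sup>2) / (rho r * (q r)\<^sup>2) * pdz L p z r)"
    by (simp add: minus_divide_left flip: mult_minus_left)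
  show ?E1 unfolding neg using eqs unfolding Mq by linarith
  have Wr: "W r = w r / r" using r by (simp add: axis_quot_def)
  have eq2: "rho r * (q r)\<^sup>2 * pdz L th z r
      = - pdr r0 p z r + 1 / r * ((w r)\<^sup>2 / c2 r) * p z r + 2 * rho r * w r / r * dw z r
        - 1 / (\<gamma> * cv) * (rho r * (w r)\<^sup>2 / r) * ds z r"
    using eqs unfolding Mq by linarith
  show ?E2 unfolding eq2 Wr by (simp add: power2_eq_square mult_ac)
  show ?E3 ?E4 using eqs by linarith+
qed

lemma initial:
  assumes r: "r \<in> {0..r0}"
  shows "p 0 r = 0" "th 0 r = 0" "dw 0 r = \<sigma> * wen r" "ds 0 r = 0"
proof -
  have init: "dU 0 r = \<lparr>st_p = 0, st_th = 0, st_w = \<sigma> * wen r, st_q = \<sigma> * qen r, st_s = 0\<rparr>"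
    if "r \<in> {0<..<r0}" for r
    using flow that unfolding linearized_flow_def Let_def by auto
  have c: "continuous_on {0..r0} (f 0)" if "C1_nozzle L r0 f" for f
    by (rule continuous_on_slice_r[OF C1_nozzle_continuous(1)[OF that]]) (use L in auto)
  note cl = eq_on_closed_by_continuity[OF r0 _ _ _ r]
  show "p 0 r = 0" "th 0 r = 0" "ds 0 r = 0"
    by (rule cl[OF c[OF C1(1)] continuous_on_const], simp add: init)
      (rule cl[OF c[OF C1(2)] continuous_on_const], simp add: init,
       rule cl[OF c[OF C1(4)] continuous_on_const], simp add: init)
  show "dw 0 r = \<sigma> * wen r"
    by (rule cl[OF c[OF C1(3)]])
      (auto simp: init intro!: continuous_intros CK_continuous_on[OF wen])
qed

lemma boundary: "z \<in> {0<..<L} \<Longrightarrow> th z r0 = 0"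
  using flow unfolding linearized_flow_def Let_def by blast

text \<open>As \<open>\<theta>\<close> vanishes on the entrance, so do the \<open>z\<close>-derivatives of pressure, swirl and entropy.\<close>

lemma pdz_entrance:
  assumes r: "r \<in> {0..r0}"
  shows "pdz L p 0 r = 0" "pdz L dw 0 r = 0" "pdz L ds 0 r = 0"
proof -
  have zero: "pdz L p 0 r = 0 \<and> pdz L dw 0 r = 0 \<and> pdz L ds 0 r = 0" if r: "r \<in> {0<..<r0}" for r
  proof -
    from r have r': "r \<in> {0..r0}" by simp
    have sz: "continuous_on {0..<L} (\<lambda>z. f z r)" "continuous_on {0..<L} (\<lambda>z. pdz L f z r)"
      "continuous_on {0..<L} (\<lambda>z. pdr r0 f z r)" if "C1_nozzle L r0 f" for f
      using C1_nozzle_continuous[OF that] by (auto intro: continuous_on_slice_z r')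
    note dst = sz(2)[OF C1(1)] sz(1)[OF C1(2)] sz(3)[OF C1(2)] sz(2)[OF C1(3)] sz(2)[OF C1(4)]
    \<comment> \<open>The equations hold for \<open>z > 0\<close> only and are extended to \<open>z = 0\<close> by continuity.\<close>
    have "pdr r0 th 0 r = rderiv r0 (\<lambda>_. 0) r"
      unfolding pdr_def by (rule rderiv_cong[OF r']) (simp add: initial)
    also have "\<dots> = 0" by (rule rderiv_eqI[OF r0 r']) simp
    finally have tr: "pdr r0 th 0 r = 0" .
    have "((M r)\<^sup>2 - 1) / (rho r * (q r)\<^sup>2) * pdz L p 0 r
      = - (pdr r0 th 0 r + 1 / r * (1 + (w r)\<^sup>2 / c2 r) * th 0 r)"
      by (rule eq_at_zero_by_continuity[OF L _ _ flow_eqs(1)])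
        (use r pos[OF r'] in \<open>auto intro!: continuous_intros dst\<close>)
    moreover have "(M r)\<^sup>2 > 1" using pos(9)[OF r'] by (simp add: one_less_power)
    ultimately have "pdz L p 0 r = 0"
      using pos[OF r'] by (simp add: tr initial[OF r'])
    moreover have "r * pdz L dw 0 r = - rderiv r0 (\<lambda>r. r * w r) r * th 0 r"
      by (rule eq_at_zero_by_continuity[OF L _ _ flow_eqs(3)])
        (use r pos[OF r'] in \<open>auto intro!: continuous_intros dst\<close>)
    moreover have "pdz L ds 0 r = - rderiv r0 s r * th 0 r"
      by (rule eq_at_zero_by_continuity[OF L _ _ flow_eqs(4)])
        (use r pos[OF r'] in \<open>auto intro!: continuous_intros dst\<close>)
    ultimately show ?thesis using r by (simp add: initial[OF r'])
  qed
  have c: "continuous_on {0..r0} (pdz L f 0)" if "C1_nozzle L r0 f" for f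
    by (rule continuous_on_slice_r[OF C1_nozzle_continuous(2)[OF that]]) (use L in auto)
  note cl = eq_on_closed_by_continuity[OF r0 c continuous_on_const _ r]
  show "pdz L p 0 r = 0" "pdz L dw 0 r = 0" "pdz L ds 0 r = 0"
    using zero by (auto intro!: cl C1)
qed

text \<open>The first derivative of \<open>I1\<close>: the \<open>i1\<close>-weighted integral of the flow angle over the cross
  section.\<close>

definition moment :: "real \<Rightarrow> real" where
  "moment z = integral {0..r0} (\<lambda>r. i1' r * th z r)"

lemma integral_cong_interior:
  fixes f g :: "real \<Rightarrow> real"
  assumes "\<And>r. r \<in> {0<..<r0} \<Longrightarrow> f r = g r"
  shows "integral {0..r0} f = integral {0..r0} g"
  by (rule integral_spike[of "{0, r0}"]) (use assms in \<open>auto simp: less_le\<close>)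

lemma moment_zero: "moment 0 = 0"
proof -
  have "moment 0 = integral {0..r0} (\<lambda>r. 0)"
    unfolding moment_def
    by (rule Henstock_Kurzweil_Integration.integral_cong) (simp add: initial)
  then show ?thesis by simp
qed

lemma I1_deriv:
  assumes z': "z \<in> {0..<L}"
  shows "(f1 has_real_derivative moment z) (at z within {0..<L})"
proof -
  define a where "a r = r * P r * (1 - k1 r) * (((M r)\<^sup>2 - 1) / (rho r * (q r)\<^sup>2))" for r
  define b where "b r = r * P r * k3 r" for r
  define Q where "Q r = P r * (1 - k1 r)" for r
  note [continuous_intros] = CK7[THEN CK_continuous_on] CK7_derived[THEN CK_continuous_on]
    CK6_i1[THEN CK_continuous_on]
  have "continuous_on {0..r0} (\<lambda>r. r * P r * (1 - k1 r) * (((q r)\<^sup>2 / c2 r - 1) / (rho r * (q r)\<^sup>2)))"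
    by (intro continuous_intros) (auto dest: pos)
  also have "?this \<longleftrightarrow> continuous_on {0..r0} a"
    by (rule continuous_on_cong) (auto simp: a_def mach_square)
  finally have a: "continuous_on {0..r0} a" .
  have b: "continuous_on {0..r0} b"
    unfolding b_def by (intro continuous_intros)
  have Q: "CK 7 r0 Q"
    unfolding Q_def by (intro CK_mult CK_diff CK_const CK7_derived r0)
  have "(f1 has_real_derivative integral {0..r0} (\<lambda>r. a r * pdz L p z r)
      + integral {0..r0} (\<lambda>r. b r * th z r)) (at z within {0..<L})"
    unfolding I1_def
    using DERIV_add[OF C1_nozzle_integral_deriv[OF C1(1) a z']
      C1_nozzle_double_integral_deriv[OF C1(2) b z']]
    by (simp add: a_def b_def)
  moreover have "integral {0..r0} (\<lambda>r. a r * pdz L p z r) + integral {0..r0} (\<lambda>r. b r * th z r)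
      = moment z"
  proof (cases "z = 0")
    case True
    have "integral {0..r0} (\<lambda>r. a r * pdz L p z r) = integral {0..r0} (\<lambda>r. 0)"
      "integral {0..r0} (\<lambda>r. b r * th z r) = integral {0..r0} (\<lambda>r. 0)"
      unfolding True
      by (intro Henstock_Kurzweil_Integration.integral_cong; simp add: pdz_entrance initial)+
    then show ?thesis by (simp add: True moment_zero)
  next
    case False
    with z' have z: "z \<in> {0<..<L}" by simp
    \<comment> \<open>\<open>G'\<close> is the derivative of \<open>Q r * (r * th z r)\<close>, which vanishes at both ends.\<close>
    define G' where "G' r = rderiv r0 Q r * (r * th z r) + Q r * (th z r + r * pdr r0 th z r)" for r
    note slice = C1_nozzle_continuous[THEN continuous_on_slice_r, OF _ z']
    have G'_int: "(G' has_integral Q r0 * (r0 * th z r0) - Q 0 * (0 * th z 0)) {0..r0}"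
    proof (rule fundamental_theorem_of_calculus)
      fix r assume r: "r \<in> {0..r0}"
      have "((\<lambda>r. Q r * (r * th z r)) has_real_derivative G' r) (at r within {0..r0})"
        unfolding G'_def
        by (rule derivative_eq_intros CK_has_rderiv7[OF Q r] C1_nozzle_has_pdr[OF C1(2) z' r] refl)+
          (simp add: algebra_simps)
      then show "((\<lambda>r. Q r * (r * th z r)) has_vector_derivative G' r) (at r within {0..r0})"
        by (simp add: has_real_derivative_iff_has_vector_derivative)
    qed (use r0 in simp)
    have "integral {0..r0} G' = 0"
      using integral_unique[OF G'_int] boundary[OF z] by simp
    moreover have "integral {0..r0} (\<lambda>r. a r * pdz L p z r) + integral {0..r0} (\<lambda>r. b r * th z r)
        = integral {0..r0} (\<lambda>r. a r * pdz L p z r + b r * th z r)"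
      by (intro Henstock_Kurzweil_Integration.integral_add[symmetric] integrable_continuous_real
          continuous_intros a b slice C1)
    moreover have "\<dots> = integral {0..r0} (\<lambda>r. i1' r * th z r - G' r)"
    proof (rule integral_cong_interior)
      fix r assume r: "r \<in> {0<..<r0}"
      then have r': "r \<in> {0..r0}" by simp
      have "(Q has_real_derivative rderiv r0 P r * (1 - k1 r) - P r * rderiv r0 k1 r)
          (at r within {0..r0})"
        unfolding Q_def
        by (rule derivative_eq_intros CK_has_rderiv7[OF CK7_derived(5) r']
            CK_has_rderiv7[OF CK7_derived(6) r'] refl)+ simp
      note Q' = rderiv_eqI[OF r0 r' this]
      have "r * rderiv r0 Q r = r * rderiv r0 P r * (1 - k1 r) - r * P r * rderiv r0 k1 r"
        unfolding Q' by (simp add: algebra_simps)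
      also have "r * rderiv r0 P r = P r * (w r)\<^sup>2 / c2p r"
        using rderiv_P[of r] r by simp
      finally have dQ:
        "r * rderiv r0 Q r = P r * (w r)\<^sup>2 / c2p r * (1 - k1 r) - r * P r * rderiv r0 k1 r" .
      have "a r * pdz L p z r = r * Q r * (((M r)\<^sup>2 - 1) / (rho r * (q r)\<^sup>2) * pdz L p z r)"
        by (simp add: a_def Q_def)
      also have "\<dots> = - (Q r * (r * pdr r0 th z r + (1 + (w r)\<^sup>2 / c2 r) * th z r))"
        unfolding flow_eqs(1)[OF z r] using r by (simp add: field_simps)
      finally have ap: "a r * pdz L p z r
          = - (Q r * (r * pdr r0 th z r + (1 + (w r)\<^sup>2 / c2 r) * th z r))" .
      have G': "G' r = (r * rderiv r0 Q r) * th z r + Q r * (th z r + r * pdr r0 th z r)"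
        by (simp add: G'_def algebra_simps)
      show "a r * pdz L p z r + b r * th z r = i1' r * th z r - G' r"
        unfolding ap G' dQ
        by (simp add: b_def Q_def i1_def swirl_eq[OF r'] algebra_simps diff_divide_distrib)
    qed
    moreover have "\<dots> = moment z - integral {0..r0} G'"
      unfolding moment_def
      by (intro Henstock_Kurzweil_Integration.integral_diff integrable_continuous_real
          continuous_intros slice C1 has_integral_integrable[OF G'_int])
    ultimately show ?thesis by simp
  qed
  ultimately show ?thesis by simp
qed

lemma I1_continuous: "continuous_on {0..<L} f1"
  using I1_deriv by (rule DERIV_continuous_on)

lemma moment_continuous: "continuous_on {0..<L} moment"
  unfolding moment_def
  by (rule DERIV_continuous_on[OF C1_nozzle_integral_deriv[OF C1(2) CK_continuous_on[OF CK6_i1(2)]]])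

text \<open>The second derivative of \<open>I1\<close> is \<open>2 * \<sigma> * I3 + o(z)\<close>.\<close>

lemma moment_deriv:
  assumes "\<eta> > 0"
  obtains d where "0 < d" "d < L"
    "\<And>z. z \<in> {0<..d} \<Longrightarrow> \<exists>y. (moment has_real_derivative y) (at z) \<and> \<bar>y - 2 * \<sigma> * f3\<bar> \<le> \<eta> * z"
proof -
  \<comment> \<open>\<open>kp\<close>, \<open>kw\<close>, \<open>ks\<close> are the factors of the pressure, the swirl increment and the entropy
    after the integration by parts, the last one up to its sign; \<open>B\<close> times a common bound of
    the three quantities bounds their total contribution, end points included.\<close>
  define g where "g r = i1' r / (rho r * (q r)\<^sup>2)" for r
  define kp where "kp r = rderiv r0 g r + g r * (W r * w r / c2 r)" for r
  define kw where "kw r = g r * (2 * rho r * W r)" for r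
  define ks where "ks r = g r * (rho r * w r * W r / (\<gamma> * cv))" for r
  define B where "B = \<bar>g r0\<bar> + \<bar>g 0\<bar> + integral {0..r0} (\<lambda>r. \<bar>kp r\<bar> + \<bar>kw r\<bar> + \<bar>ks r\<bar>)"
  note [continuous_intros] = CK7[THEN CK_continuous_on] CK7_derived[THEN CK_continuous_on]
    CK6_i1[THEN CK_continuous_on] W_continuous CK_continuous_on[OF wen]
  have g: "CK 6 r0 g"
    unfolding g_def
    by (intro CK_divide CK_mult CK_power2 r0 CK6_i1 CK6 CK7 CK7_derived)
      (auto intro!: mult_pos_pos zero_less_power pos)
  have g': "continuous_on {0..r0} (rderiv r0 g)"
    using g CK_Suc[of 5] by (auto intro: CK_continuous_on)
  note [continuous_intros] = CK_continuous_on[OF g] g'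
  have kp: "continuous_on {0..r0} kp"
    unfolding kp_def by (intro continuous_intros) (auto dest: pos)
  have kws: "continuous_on {0..r0} kw" "continuous_on {0..r0} ks"
    unfolding kw_def ks_def using gamma cv by - (intro continuous_intros; simp)+
  note [continuous_intros] = kp kws
  have "0 \<le> integral {0..r0} (\<lambda>r. \<bar>kp r\<bar> + \<bar>kw r\<bar> + \<bar>ks r\<bar>)"
    by (intro Henstock_Kurzweil_Integration.integral_nonneg integrable_continuous_real
        continuous_intros) auto
  then have B: "B \<ge> 0" by (simp add: B_def)
  define \<epsilon> where "\<epsilon> = \<eta> / (B + 1)"
  have \<epsilon>: "\<epsilon> > 0" "\<epsilon> * B \<le> \<eta>"
    using assms B by (auto simp: \<epsilon>_def field_simps)
  obtain d1 where d1: "0 < d1" "d1 < L"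
    "\<And>z r. z \<in> {0..d1} \<Longrightarrow> r \<in> {0..r0} \<Longrightarrow> \<bar>p z r - p 0 r\<bar> \<le> \<epsilon> * z"
    using C1_nozzle_small[OF C1(1) L pdz_entrance(1) \<epsilon>(1)] by blast
  obtain d2 where d2: "0 < d2" "d2 < L"
    "\<And>z r. z \<in> {0..d2} \<Longrightarrow> r \<in> {0..r0} \<Longrightarrow> \<bar>dw z r - dw 0 r\<bar> \<le> \<epsilon> * z"
    using C1_nozzle_small[OF C1(3) L pdz_entrance(2) \<epsilon>(1)] by blast
  obtain d3 where d3: "0 < d3" "d3 < L"
    "\<And>z r. z \<in> {0..d3} \<Longrightarrow> r \<in> {0..r0} \<Longrightarrow> \<bar>ds z r - ds 0 r\<bar> \<le> \<epsilon> * z"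
    using C1_nozzle_small[OF C1(4) L pdz_entrance(3) \<epsilon>(1)] by blast
  define d where "d = min d1 (min d2 d3)"
  have d: "0 < d" "d < L" using d1 d2 d3 by (auto simp: d_def)
  have "\<exists>y. (moment has_real_derivative y) (at z) \<and> \<bar>y - 2 * \<sigma> * f3\<bar> \<le> \<eta> * z"
    if zd: "z \<in> {0<..d}" for z
  proof -
    have z: "z \<in> {0<..<L}" and z': "z \<in> {0..<L}" using zd d by auto
    have small: "\<bar>p z r\<bar> \<le> \<epsilon> * z" "\<bar>dw z r - \<sigma> * wen r\<bar> \<le> \<epsilon> * z" "\<bar>ds z r\<bar> \<le> \<epsilon> * z"
      if "r \<in> {0..r0}" for r
      using d1(3)[of z r] d2(3)[of z r] d3(3)[of z r] that zd initial[OF that]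
      by (auto simp: d_def)
    define y where "y = integral {0..r0} (\<lambda>r. i1' r * pdz L th z r)"
    have "(moment has_real_derivative y) (at z within {0..<L})"
      unfolding moment_def y_def
      by (rule C1_nozzle_integral_deriv[OF C1(2) CK_continuous_on[OF CK6_i1(2)] z'])
    moreover have "at z within {0..<L} = at z"
      by (rule at_within_interior) (use z in auto)
    ultimately have deriv: "(moment has_real_derivative y) (at z)" by simp
    note slice = C1_nozzle_continuous[THEN continuous_on_slice_r, OF _ z']
    \<comment> \<open>\<open>G'\<close> is the derivative of \<open>g r * p z r\<close>; subtracting it removes the radial derivative
      of the pressure.\<close>
    define G' where "G' r = rderiv r0 g r * p z r + g r * pdr r0 p z r" for r
    have G': "(G' has_integral g r0 * p z r0 - g 0 * p z 0) {0..r0}"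
    proof (rule fundamental_theorem_of_calculus)
      fix r assume r: "r \<in> {0..r0}"
      have g_deriv: "(g has_real_derivative rderiv r0 g r) (at r within {0..r0})"
        using CK_has_rderiv[of 5 r0 g r] g r by simp
      have "((\<lambda>r. g r * p z r) has_real_derivative G' r) (at r within {0..r0})"
        unfolding G'_def
        by (rule derivative_eq_intros g_deriv C1_nozzle_has_pdr[OF C1(1) z' r] refl)+
          (simp add: algebra_simps)
      then show "((\<lambda>r. g r * p z r) has_vector_derivative G' r) (at r within {0..r0})"
        by (simp add: has_real_derivative_iff_has_vector_derivative)
    qed (use r0 in simp)
    define E where "E r = kp r * p z r + kw r * (dw z r - \<sigma> * wen r) - ks r * ds z r" for r
    have E: "continuous_on {0..r0} E"
      unfolding E_def by (intro continuous_intros slice C1)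
    have f3: "f3 = integral {0..r0} (\<lambda>r. i1' r / (q r)\<^sup>2 * W r * wen r)"
      unfolding I3_def by (rule integral_cong_interior) (auto simp: axis_quot_def)
    have c3: "continuous_on {0..r0} (\<lambda>r. i1' r / (q r)\<^sup>2 * W r * wen r)"
      by (intro continuous_intros) (auto dest: pos)
    have "y = integral {0..r0} (\<lambda>r. 2 * \<sigma> * (i1' r / (q r)\<^sup>2 * W r * wen r) + E r - G' r)"
      unfolding y_def
    proof (rule integral_cong_interior)
      fix r assume r: "r \<in> {0<..<r0}"
      then have r': "r \<in> {0..r0}" by simp
      have i1: "i1' r = g r * (rho r * (q r)\<^sup>2)" and ig: "i1' r / (q r)\<^sup>2 = g r * rho r"
        using pos[OF r'] by (auto simp: g_def)
      have "i1' r * pdz L th z r = g r * (rho r * (q r)\<^sup>2 * pdz L th z r)"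
        by (simp add: i1)
      also have "\<dots> = 2 * \<sigma> * (i1' r / (q r)\<^sup>2 * W r * wen r) + E r - G' r"
        unfolding flow_eqs(2)[OF z r] ig E_def G'_def kp_def kw_def ks_def
        by (simp add: algebra_simps)
      finally show "i1' r * pdz L th z r
        = 2 * \<sigma> * (i1' r / (q r)\<^sup>2 * W r * wen r) + E r - G' r" .
    qed
    also have "\<dots> = 2 * \<sigma> * f3 + integral {0..r0} E - (g r0 * p z r0 - g 0 * p z 0)"
      unfolding f3
      by (intro integral_unique has_integral_diff has_integral_add has_integral_mult_right G'
          integrable_integral integrable_continuous_real c3 E)
    finally have y: "y - 2 * \<sigma> * f3 = integral {0..r0} E - g r0 * p z r0 + g 0 * p z 0" by simp
    have "norm (integral {0..r0} E)
        \<le> integral {0..r0} (\<lambda>r. (\<bar>kp r\<bar> + \<bar>kw r\<bar> + \<bar>ks r\<bar>) * (\<epsilon> * z))"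
    proof (rule integral_norm_bound_integral)
      fix r assume r: "r \<in> {0..r0}"
      have "norm (E r) \<le> \<bar>kp r\<bar> * \<bar>p z r\<bar> + \<bar>kw r\<bar> * \<bar>dw z r - \<sigma> * wen r\<bar> + \<bar>ks r\<bar> * \<bar>ds z r\<bar>"
        unfolding E_def abs_mult[symmetric] real_norm_def by linarith
      also have "\<dots> \<le> \<bar>kp r\<bar> * (\<epsilon> * z) + \<bar>kw r\<bar> * (\<epsilon> * z) + \<bar>ks r\<bar> * (\<epsilon> * z)"
        by (intro add_mono mult_left_mono small r) auto
      finally show "norm (E r) \<le> (\<bar>kp r\<bar> + \<bar>kw r\<bar> + \<bar>ks r\<bar>) * (\<epsilon> * z)"
        by (simp add: distrib_right)
    qed (intro integrable_continuous_real continuous_intros E)+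
    also have "\<dots> = integral {0..r0} (\<lambda>r. \<bar>kp r\<bar> + \<bar>kw r\<bar> + \<bar>ks r\<bar>) * (\<epsilon> * z)"
      by (rule integral_mult_left)
    finally have "\<bar>integral {0..r0} E\<bar>
        \<le> integral {0..r0} (\<lambda>r. \<bar>kp r\<bar> + \<bar>kw r\<bar> + \<bar>ks r\<bar>) * (\<epsilon> * z)"
      by simp
    moreover have "\<bar>g r0 * p z r0\<bar> \<le> \<bar>g r0\<bar> * (\<epsilon> * z)" "\<bar>g 0 * p z 0\<bar> \<le> \<bar>g 0\<bar> * (\<epsilon> * z)"
      unfolding abs_mult using r0 by (auto intro!: mult_left_mono small)
    ultimately have "\<bar>y - 2 * \<sigma> * f3\<bar> \<le> B * (\<epsilon> * z)"
      unfolding y B_def distrib_right by linarith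
    also have "\<dots> \<le> \<eta> * z"
      using mult_right_mono[OF \<epsilon>(2), of z] zd by (simp add: mult_ac)
    finally show ?thesis using deriv by blast
  qed
  with that d show ?thesis by blast
qed

end

section \<open>The behaviour of \<open>I1\<close> near the entrance\<close>

context linear_flow
begin

lemma I1_zero: "f1 0 = 0"
proof -
  have "integral {0..r0} (\<lambda>r. r * P r * (1 - k1 r)
       * (((M r)\<^sup>2 - 1) / (rho r * (q r)\<^sup>2)) * p 0 r) = integral {0..r0} (\<lambda>r. 0)"
    by (rule Henstock_Kurzweil_Integration.integral_cong) (simp add: initial)
  then show ?thesis by (simp add: I1_def)
qed

lemma integral_abs_i1_pos:
  assumes "f3 \<noteq> 0"
  shows "0 < integral {0..r0} (\<lambda>r. \<bar>i1' r\<bar>)"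
proof -
  have c: "continuous_on {0..r0} (\<lambda>r. \<bar>i1' r\<bar>)"
    using CK_continuous_on[OF CK6_i1(2)] by (intro continuous_intros)
  have "integral {0..r0} (\<lambda>r. \<bar>i1' r\<bar>) \<noteq> 0"
  proof
    assume "integral {0..r0} (\<lambda>r. \<bar>i1' r\<bar>) = 0"
    then have "\<forall>r\<in>{0..r0}. i1' r = 0"
      using integral_eq_0_iff[OF c r0] by auto
    then have "f3 = integral {0..r0} (\<lambda>r. 0)"
      unfolding I3_def by (intro Henstock_Kurzweil_Integration.integral_cong) simp
    with assms show False by simp
  qed
  moreover have "0 \<le> integral {0..r0} (\<lambda>r. \<bar>i1' r\<bar>)"
    by (rule Henstock_Kurzweil_Integration.integral_nonneg[OF integrable_continuous_real[OF c]]) simp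
  ultimately show ?thesis by linarith
qed

lemma I1_deriv_interior:
  assumes "z \<in> {0<..<L}"
  shows "(f1 has_real_derivative moment z) (at z)"
  using I1_deriv[of z] at_within_interior[of z "{0..<L}"] assms by simp

lemma I1_lower_bound:
  assumes "\<sigma> > 0" "f3 > 0" "\<eta> > 0"
  obtains d where "0 < d" "d < L" "continuous_on {0..d} f1"
    "\<And>x y. 0 \<le> x \<Longrightarrow> x < y \<Longrightarrow> y \<le> d \<Longrightarrow> f1 x < f1 y"
    "\<And>z. z \<in> {0..d} \<Longrightarrow> \<sigma> * f3 * z\<^sup>2 - \<eta> * z ^ 3 / 6 \<le> f1 z"
proof -
  obtain d0 where d0: "0 < d0" "d0 < L"
    "\<And>z. z \<in> {0<..d0} \<Longrightarrow> \<exists>y. (moment has_real_derivative y) (at z) \<and> \<bar>y - 2 * \<sigma> * f3\<bar> \<le> \<eta> * z"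
    using moment_deriv[OF assms(3)] by blast
  \<comment> \<open>The bound \<open>\<sigma> * f3 / \<eta>\<close> keeps \<open>moment\<close> positive on \<open>(0, d]\<close>.\<close>
  define d where "d = min d0 (\<sigma> * f3 / \<eta>)"
  have d: "0 < d" "d \<le> d0" "d \<le> \<sigma> * f3 / \<eta>"
    using d0 assms by (auto simp: d_def)
  then have d: "0 < d" "d \<le> d0" "d < L" "\<eta> * d \<le> \<sigma> * f3"
    using d0 assms by (auto simp: field_simps)
  have c: "continuous_on {0..d} f1" "continuous_on {0..d} moment"
    using I1_continuous moment_continuous d by (auto intro: continuous_on_subset)
  have moment_bound: "2 * \<sigma> * f3 * z - \<eta> * z\<^sup>2 / 2 \<le> moment z" if z: "z \<in> {0..d}" for z
  proof -
    define h where "h z = moment z - (2 * \<sigma> * f3 * z - \<eta> * z\<^sup>2 / 2)" for z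
    have "h 0 \<le> h z"
    proof (rule DERIV_nonneg_imp_increasing_open[of 0 z h])
      fix x assume x: "0 < x" "x < z"
      then obtain y where y: "(moment has_real_derivative y) (at x)" "\<bar>y - 2 * \<sigma> * f3\<bar> \<le> \<eta> * x"
        using d0(3)[of x] z d by auto
      have "(h has_real_derivative y - (2 * \<sigma> * f3 - \<eta> * x)) (at x)"
        unfolding h_def by (auto intro!: derivative_eq_intros y(1))
      with y(2) show "\<exists>D. (h has_real_derivative D) (at x) \<and> 0 \<le> D"
        by (intro exI[of _ "y - (2 * \<sigma> * f3 - \<eta> * x)"]) linarith
    next
      show "continuous_on {0..z} h"
        unfolding h_def using z
        by (intro continuous_intros continuous_on_subset[OF c(2)]) auto
    qed (use z in auto)
    then show ?thesis by (simp add: h_def moment_zero)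
  qed
  have moment_pos: "moment z > 0" if z: "z \<in> {0<..d}" for z
  proof -
    have "\<eta> * z \<le> \<eta> * d"
      using assms(3) z by simp
    then have "\<eta> * z \<le> \<sigma> * f3"
      using d(4) by linarith
    then have "\<eta> * z\<^sup>2 / 2 \<le> \<sigma> * f3 * z / 2"
      using z mult_right_mono[of "\<eta> * z" "\<sigma> * f3" z] by (simp add: power2_eq_square)
    moreover have "\<sigma> * f3 * z > 0" using assms z by simp
    ultimately show ?thesis using moment_bound[of z] z by simp
  qed
  have mono: "f1 x < f1 y" if "0 \<le> x" "x < y" "y \<le> d" for x y
  proof (rule DERIV_pos_imp_increasing_open[of x y f1])
    fix z assume "x < z" "z < y"
    then show "\<exists>D. (f1 has_real_derivative D) (at z) \<and> 0 < D"
      using that d I1_deriv_interior[of z] moment_pos[of z] by auto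
  qed (use that in \<open>auto intro: continuous_on_subset[OF c(1)]\<close>)
  have "\<sigma> * f3 * z\<^sup>2 - \<eta> * z ^ 3 / 6 \<le> f1 z" if z: "z \<in> {0..d}" for z
  proof -
    define h where "h z = f1 z - (\<sigma> * f3 * z\<^sup>2 - \<eta> * z ^ 3 / 6)" for z
    have "h 0 \<le> h z"
    proof (rule DERIV_nonneg_imp_increasing_open[of 0 z h])
      fix x assume x: "0 < x" "x < z"
      have "(h has_real_derivative moment x - (2 * \<sigma> * f3 * x - \<eta> * x\<^sup>2 / 2)) (at x)"
        unfolding h_def using x z d
        by (auto intro!: derivative_eq_intros I1_deriv_interior simp: power2_eq_square)
      moreover have "0 \<le> moment x - (2 * \<sigma> * f3 * x - \<eta> * x\<^sup>2 / 2)"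
        using moment_bound[of x] x z by simp
      ultimately show "\<exists>D. (h has_real_derivative D) (at x) \<and> 0 \<le> D" by blast
    next
      show "continuous_on {0..z} h"
        unfolding h_def using z
        by (intro continuous_intros continuous_on_subset[OF c(1)]) auto
    qed (use z in auto)
    then show ?thesis by (simp add: h_def I1_zero)
  qed
  with that d c mono show ?thesis by blast
qed

end


theorem lemma2p11:
  fixes \<gamma> A cv L r0 :: real and Um :: "real \<Rightarrow> flow_state"
  assumes "\<gamma> > 1" and "A > 0" and "cv > 0" and "L > 0" and "r0 > 0"
  shows "\<exists>C>0. \<forall>Up \<sigma> wen qen dU.
    \<sigma> > 0 \<and>
    special_shock_pair \<gamma> A cv r0 Um Up \<and>
    CK 7 r0 wen \<and> CK 7 r0 qen \<and>
    structural_bg r0 Um \<and> structural_en r0 wen qen \<and>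
    compatible7 \<gamma> A cv r0 \<sigma> wen qen Um \<and>
    linearized_flow \<gamma> A cv L r0 Um \<sigma> wen qen dU \<and>
    I3 \<gamma> A cv r0 Um Up wen > 0 \<longrightarrow>
    (\<exists>Ls. 0 < Ls \<and> Ls \<le> L \<and>
       Ls < 4 * I3 \<gamma> A cv r0 Um Up wen /
              (C * (H7_norm r0 wen + H7_norm r0 qen) *
               integral {0..r0} (\<lambda>r. \<bar>i1 \<gamma> A cv r0 Um Up r\<bar>)) \<and>
       (\<forall>\<alpha> pex.
          0 < \<alpha> \<and> \<alpha> < 1 \<and> C2_holder \<alpha> r0 pex \<and> structural_ex r0 pex \<and>
          0 < I2 \<gamma> A cv r0 Um Up qen pex \<and>
          I2 \<gamma> A cv r0 Um Up qen pex \<le> Ls\<^sup>2 *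
            (I3 \<gamma> A cv r0 Um Up wen
             - C * (H7_norm r0 wen + H7_norm r0 qen) / 6 * Ls *
               integral {0..r0} (\<lambda>r. \<bar>i1 \<gamma> A cv r0 Um Up r\<bar>)) \<longrightarrow>
          (\<exists>!z. z \<in> {0<..<Ls} \<and>
             I1 \<gamma> A cv r0 Um Up dU z = \<sigma> * I2 \<gamma> A cv r0 Um Up qen pex)))"
proof (rule exI[of _ 1], intro conjI allI impI)
  fix Up \<sigma> wen qen dU
  assume H: "\<sigma> > 0 \<and>
    special_shock_pair \<gamma> A cv r0 Um Up \<and>
    CK 7 r0 wen \<and> CK 7 r0 qen \<and>
    structural_bg r0 Um \<and> structural_en r0 wen qen \<and>
    compatible7 \<gamma> A cv r0 \<sigma> wen qen Um \<and>
    linearized_flow \<gamma> A cv L r0 Um \<sigma> wen qen dU \<and>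
    I3 \<gamma> A cv r0 Um Up wen > 0"
  interpret linear_flow \<gamma> A cv r0 Um Up L \<sigma> wen qen dU
    using H assms by unfold_locales (auto simp: structural_bg_def)
  define N where "N = H7_norm r0 wen + H7_norm r0 qen"
  define K where "K = integral {0..r0} (\<lambda>r. \<bar>i1' r\<bar>)"
  from H have sigma: "\<sigma> > 0" and f3: "f3 > 0" by auto
  obtain r where "r \<in> {0<..<r0}" "wen r \<noteq> 0"
    using H by (auto simp: structural_en_def)
  then have "N > 0"
    unfolding N_def using H7_norm_pos[OF r0 wen, of r] H7_norm_nonneg[of r0 qen] by auto
  moreover have "K > 0"
    unfolding K_def using f3 by (intro integral_abs_i1_pos) auto
  ultimately have NK: "N * K > 0" by simp
  \<comment> \<open>Half of the third-order constant \<open>\<sigma> * N * K\<close> allowed by the bound on \<open>I2\<close>, so that the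
    value at \<open>Ls\<close> exceeds that bound strictly and the root lies in the open interval.\<close>
  define \<eta> where "\<eta> = \<sigma> * N * K / 2"
  have eta: "\<eta> > 0" using sigma NK by (simp add: \<eta>_def mult.assoc)
  obtain d where d: "0 < d" "d < L" "continuous_on {0..d} f1"
    "\<And>x y. 0 \<le> x \<Longrightarrow> x < y \<Longrightarrow> y \<le> d \<Longrightarrow> f1 x < f1 y"
    "\<And>z. z \<in> {0..d} \<Longrightarrow> \<sigma> * f3 * z\<^sup>2 - \<eta> * z ^ 3 / 6 \<le> f1 z"
    using I1_lower_bound[OF sigma f3 eta] by blast
  define Ls where "Ls = min d (2 * f3 / (N * K))"
  have Ls: "0 < Ls" "Ls \<le> d" using d f3 NK by (auto simp: Ls_def)
  have Ls4: "Ls < 4 * f3 / (N * K)"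
    using NK f3 by (auto simp: Ls_def min_less_iff_disj divide_strict_right_mono)
  have root: "\<exists>!z. z \<in> {0<..<Ls} \<and> f1 z = \<sigma> * I"
    if I: "0 < I" "I \<le> Ls\<^sup>2 * (f3 - N / 6 * Ls * K)" for I
  proof -
    have "\<sigma> * I \<le> \<sigma> * (Ls\<^sup>2 * (f3 - N / 6 * Ls * K))"
      using I sigma by simp
    also have "\<dots> = \<sigma> * f3 * Ls\<^sup>2 - 2 * \<eta> * Ls ^ 3 / 6"
      by (simp add: \<eta>_def algebra_simps power2_eq_square power3_eq_cube)
    also have "\<dots> < \<sigma> * f3 * Ls\<^sup>2 - \<eta> * Ls ^ 3 / 6"
      using eta Ls by simp
    also have "\<dots> \<le> f1 Ls"
      using d(5)[of Ls] Ls by simp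
    finally have upper: "\<sigma> * I < f1 Ls" .
    have lower: "f1 0 < \<sigma> * I"
      using sigma I by (simp add: I1_zero)
    obtain z where z: "0 \<le> z" "z \<le> Ls" "f1 z = \<sigma> * I"
      using IVT'[of f1 0 "\<sigma> * I" Ls] upper lower Ls continuous_on_subset[OF d(3), of "{0..Ls}"]
      by auto
    show ?thesis
    proof (rule ex1I[of _ z])
      show "z \<in> {0<..<Ls} \<and> f1 z = \<sigma> * I"
        using z upper lower by (auto simp: less_le)
    next
      fix x assume x: "x \<in> {0<..<Ls} \<and> f1 x = \<sigma> * I"
      show "x = z"
        using d(4)[of x z] d(4)[of z x] x z Ls by (cases x z rule: linorder_cases) auto
    qed
  qed
  show "\<exists>Ls>0. Ls \<le> L \<and>
       Ls < 4 * f3 / (1 * (H7_norm r0 wen + H7_norm r0 qen) * integral {0..r0} (\<lambda>r. \<bar>i1' r\<bar>)) \<and>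
       (\<forall>\<alpha> pex.
          0 < \<alpha> \<and> \<alpha> < 1 \<and> C2_holder \<alpha> r0 pex \<and> structural_ex r0 pex \<and>
          0 < I2 \<gamma> A cv r0 Um Up qen pex \<and>
          I2 \<gamma> A cv r0 Um Up qen pex \<le> Ls\<^sup>2 *
            (f3 - 1 * (H7_norm r0 wen + H7_norm r0 qen) / 6 * Ls * integral {0..r0} (\<lambda>r. \<bar>i1' r\<bar>)) \<longrightarrow>
          (\<exists>!z. z \<in> {0<..<Ls} \<and> f1 z = \<sigma> * I2 \<gamma> A cv r0 Um Up qen pex))"
    unfolding N_def[symmetric] K_def[symmetric]
    using Ls d(2) Ls4 root by (intro exI[of _ Ls]) auto
qed simp

end
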